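(* Let $A$ be any algorithm which is given access to independent samples from an unknown distribution $\mathcal{D}$ on $\mathbb{R}^n$ and has the following guarantee: (1) if $\mathcal{D} = N(0,I_n)$, then with probability at least $9/10$ it outputs "un-truncated"; (2) if $\mathcal{D}\in\mathcal{P}_{\mathrm{symm}}$ and $d_{\mathrm{TV}}(\mathcal{D}, N(0,I_n)) = 1$, then with probability at least $9/10$ it outputs "truncated". Then $A$ must use at least $\Omega(n)$ samples from $\mathcal{D}$.
   Context: For a symmetric convex set $K \subseteq \mathbb{R}^n$ (symmetric meaning $-x\in K$ whenever $x\in K$), $N(0,I_n)|_K$ denotes the standard Gaussian conditioned on $K$: if $\mathrm{vol}(K) := \Pr_{x\sim N(0,I_n)}[x\in K]>0$ it has density $\mathrm{vol}(K)^{-1}\varphi_n(x)\mathbf{1}[x\in K]$. For sets of Gaussian measure zero the conditioning is defined via a limiting sequence; in particular, for an origin-centered hyperplane $K = v^\perp = \{x : \langle x, v\rangle = 0\}$ ($v$ a unit vector), $N(0,I_n)|_K$ is the limit as $\epsilon\to 0$ of $N(0,I_n)$ conditioned on the slab $\{x : |\langle v,x\rangle|\le\epsilon\}$, i.e. the standard $(n-1)$-dimensional Gaussian on the subspace $v^\perp$. $\mathcal{P}_{\mathrm{symm}}$ is the class of all distributions $N(0,I_n)|_K$ with $K$ symmetric convex. $d_{\mathrm{TV}}$ denotes total variation distance. *)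

theory Defs
  imports "HOL-Probability.Probability"
begin

text \<open>
  The constant hidden in \<open>\<Omega>(n)\<close> is uniform in the dimension, so \<open>n\<close> has to be a term and not a
  type.  A point of \<open>\<real>\<^sup>n\<close> is a function \<^typ>\<open>nat \<Rightarrow> real\<close> that is extensional on \<open>{..<n}\<close>, which is
  the convention of \<^const>\<open>PiM\<close> and of \<^const>\<open>product_topology\<close>.  Functions do not form a
  \<^class>\<open>real_vector\<close>, so symmetry, convexity and Euclidean distance are spelled out.
\<close>

definition borel_Rn :: "nat \<Rightarrow> (nat \<Rightarrow> real) measure" where
  "borel_Rn n = PiM {..<n} (\<lambda>_. borel)"

definition Rn :: "nat \<Rightarrow> (nat \<Rightarrow> real) set" where
  "Rn n = {..<n} \<rightarrow>\<^sub>E UNIV"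

definition Rn_topology :: "nat \<Rightarrow> (nat \<Rightarrow> real) topology" where
  "Rn_topology n = product_topology (\<lambda>_. euclideanreal) {..<n}"

definition Rn_dist :: "nat \<Rightarrow> (nat \<Rightarrow> real) \<Rightarrow> (nat \<Rightarrow> real) \<Rightarrow> real" where
  "Rn_dist n x y = sqrt (\<Sum>i<n. (x i - y i)\<^sup>2)"

definition Rn_convex :: "nat \<Rightarrow> (nat \<Rightarrow> real) set \<Rightarrow> bool" where
  "Rn_convex n K \<longleftrightarrow> (\<forall>x\<in>K. \<forall>y\<in>K. \<forall>u\<ge>0. \<forall>v\<ge>0. u + v = 1 \<longrightarrow> (\<lambda>i\<in>{..<n}. u * x i + v * y i) \<in> K)"

definition Rn_symmetric :: "nat \<Rightarrow> (nat \<Rightarrow> real) set \<Rightarrow> bool" where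
  "Rn_symmetric n K \<longleftrightarrow> (\<forall>x\<in>K. (\<lambda>i\<in>{..<n}. - x i) \<in> K)"

definition std_gaussian :: "nat \<Rightarrow> (nat \<Rightarrow> real) measure" where
  "std_gaussian n = PiM {..<n} (\<lambda>_. density lborel std_normal_density)"

text \<open>
  Convex sets are Lebesgue but not always Borel measurable; hence the completion.
\<close>

definition gaussian_vol :: "nat \<Rightarrow> (nat \<Rightarrow> real) set \<Rightarrow> real" where
  "gaussian_vol n K = measure (completion (std_gaussian n)) K"

text \<open>
  Conditioning on a set of positive Gaussian measure; the outer \<^const>\<open>distr\<close> only restricts the
  conditioned measure from the completed \<open>\<sigma>\<close>-algebra back to the Borel sets.
\<close>

definition gaussian_cond :: "nat \<Rightarrow> (nat \<Rightarrow> real) set \<Rightarrow> (nat \<Rightarrow> real) measure" where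
  "gaussian_cond n K = distr (uniform_measure (completion (std_gaussian n)) K) (borel_Rn n) (\<lambda>x. x)"

definition thickening :: "nat \<Rightarrow> real \<Rightarrow> (nat \<Rightarrow> real) set \<Rightarrow> (nat \<Rightarrow> real) set" where
  "thickening n \<epsilon> K = {x \<in> Rn n. \<exists>y\<in>K. Rn_dist n x y \<le> \<epsilon>}"

definition weak_limit_at_0 :: "nat \<Rightarrow> (real \<Rightarrow> (nat \<Rightarrow> real) measure) \<Rightarrow> (nat \<Rightarrow> real) measure \<Rightarrow> bool" where
  "weak_limit_at_0 n M D \<longleftrightarrow>
     (\<forall>f. continuous_map (Rn_topology n) euclideanreal f \<longrightarrow> bounded (f ` Rn n) \<longrightarrow>
        ((\<lambda>\<epsilon>. \<integral>x. f x \<partial>M \<epsilon>) \<longlongrightarrow> (\<integral>x. f x \<partial>D)) (at_right 0))"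

text \<open>
  \<open>is_gaussian_on n K D\<close> says that \<open>D\<close> is \<open>N(0,I\<^sub>n)|\<^sub>K\<close>.  If \<open>K\<close> is a null set, the conditioning is
  the weak limit, as \<open>\<epsilon>\<close> tends to \<open>0\<close> from above, of conditioning on the points at distance at most
  \<open>\<epsilon>\<close> from \<open>K\<close>.  For an origin-centered hyperplane these thickenings are the slabs
  (\<open>thickening_hyperplane\<close> below).  No \<open>D\<close> qualifies for \<open>K = {}\<close>.
\<close>

definition is_gaussian_on :: "nat \<Rightarrow> (nat \<Rightarrow> real) set \<Rightarrow> (nat \<Rightarrow> real) measure \<Rightarrow> bool" where
  "is_gaussian_on n K D \<longleftrightarrow>
     prob_space D \<and> sets D = sets (borel_Rn n) \<and>
     (if gaussian_vol n K > 0 then D = gaussian_cond n K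
      else weak_limit_at_0 n (\<lambda>\<epsilon>. gaussian_cond n (thickening n \<epsilon> K)) D)"

definition P_symm :: "nat \<Rightarrow> (nat \<Rightarrow> real) measure set" where
  "P_symm n = {D. \<exists>K \<subseteq> Rn n. Rn_symmetric n K \<and> Rn_convex n K \<and> is_gaussian_on n K D}"

definition tv_dist :: "'a measure \<Rightarrow> 'a measure \<Rightarrow> real" where
  "tv_dist M N = (SUP A\<in>sets M. \<bar>measure M A - measure N A\<bar>)"

datatype verdict = Untruncated | Truncated

text \<open>
  A possibly randomized algorithm that uses (at most) \<open>m\<close> samples is a Markov kernel from
  \<open>(\<real>\<^sup>n)\<^sup>m\<close> to the verdicts.
\<close>

definition algorithms :: "nat \<Rightarrow> nat \<Rightarrow> ((nat \<Rightarrow> nat \<Rightarrow> real) \<Rightarrow> verdict measure) set" where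
  "algorithms n m = PiM {..<m} (\<lambda>_. borel_Rn n) \<rightarrow>\<^sub>M prob_algebra (count_space UNIV)"

definition output_prob ::
  "nat \<Rightarrow> ((nat \<Rightarrow> nat \<Rightarrow> real) \<Rightarrow> verdict measure) \<Rightarrow> (nat \<Rightarrow> real) measure \<Rightarrow> verdict \<Rightarrow> real" where
  "output_prob m A D r = measure (PiM {..<m} (\<lambda>_. D) \<bind> A) {r}"

lemma thickening_hyperplane:
  assumes v: "(\<Sum>i<n. (v i)\<^sup>2) = 1" and "\<epsilon> \<ge> 0"
  shows "thickening n \<epsilon> {x \<in> Rn n. (\<Sum>i<n. x i * v i) = 0} = {x \<in> Rn n. \<bar>\<Sum>i<n. x i * v i\<bar> \<le> \<epsilon>}"
proof (intro set_eqI iffI)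
  fix x assume "x \<in> thickening n \<epsilon> {x \<in> Rn n. (\<Sum>i<n. x i * v i) = 0}"
  then obtain y where x: "x \<in> Rn n" and y: "(\<Sum>i<n. y i * v i) = 0" "Rn_dist n x y \<le> \<epsilon>"
    by (auto simp: thickening_def)
  have "\<bar>\<Sum>i<n. x i * v i\<bar> = \<bar>\<Sum>i<n. (x i - y i) * v i\<bar>"
    using y(1) by (simp add: left_diff_distrib sum_subtractf)
  also have "\<dots> \<le> (\<Sum>i<n. \<bar>x i - y i\<bar> * \<bar>v i\<bar>)"
    using sum_abs[of "\<lambda>i. (x i - y i) * v i" "{..<n}"] by (simp add: abs_mult)
  also have "\<dots> \<le> L2_set (\<lambda>i. x i - y i) {..<n} * L2_set v {..<n}"
    by (rule L2_set_mult_ineq)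
  also have "\<dots> \<le> \<epsilon>"
    using y(2) v by (simp add: L2_set_def Rn_dist_def)
  finally show "x \<in> {x \<in> Rn n. \<bar>\<Sum>i<n. x i * v i\<bar> \<le> \<epsilon>}"
    using x by simp
next
  fix x assume x: "x \<in> {x \<in> Rn n. \<bar>\<Sum>i<n. x i * v i\<bar> \<le> \<epsilon>}"
  define t where "t = (\<Sum>i<n. x i * v i)"
  define y where "y = (\<lambda>i\<in>{..<n}. x i - t * v i)"
  have "(\<Sum>i<n. y i * v i) = (\<Sum>i<n. x i * v i - t * (v i)\<^sup>2)"
    by (rule sum.cong) (auto simp: y_def algebra_simps power2_eq_square)
  also have "\<dots> = 0"
    using v by (simp add: sum_subtractf t_def flip: sum_distrib_left)
  finally have "(\<Sum>i<n. y i * v i) = 0" .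
  moreover have "y \<in> Rn n"
    by (simp add: y_def Rn_def)
  moreover have "Rn_dist n x y \<le> \<epsilon>"
  proof -
    have "(\<Sum>i<n. (x i - y i)\<^sup>2) = (\<Sum>i<n. t\<^sup>2 * (v i)\<^sup>2)"
      by (rule sum.cong) (auto simp: y_def power_mult_distrib)
    also have "\<dots> = t\<^sup>2"
      using v by (simp flip: sum_distrib_left)
    finally show ?thesis
      using x by (simp add: Rn_dist_def t_def)
  qed
  ultimately show "x \<in> thickening n \<epsilon> {x \<in> Rn n. (\<Sum>i<n. x i * v i) = 0}"
    using x by (auto simp: thickening_def)
qed

end

theory Submission
  imports Defs
begin

text \<open>
  Let \<open>v\<close> be a uniformly random unit vector.  The standard Gaussian on the hyperplane orthogonal to \<open>v\<close> is
  at total variation distance \<open>1\<close> from \<open>N(0,I\<^sub>n)\<close>, but the mixture over \<open>v\<close> of their \<open>m\<close>-fold products is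
  close to \<open>N(0,I\<^sub>n)\<^sup>m\<close> when \<open>m \<le> n/5\<close>.  To see this, smear the component along \<open>v\<close> uniformly over
  \<open>[-\<epsilon>, \<epsilon>]\<close>.  The smeared product has a density with respect to \<open>N(0,I\<^sub>n)\<^sup>m\<close>, and for two unit vectors
  \<open>v\<close>, \<open>w\<close> the inner product of the densities is at most \<open>exp (\<epsilon>\<^sup>2 m / 2) (1 - \<langle>v, w\<rangle>\<^sup>2)\<^sup>-\<^sup>m\<close>.  The average
  of \<open>(1 - \<langle>v, w\<rangle>\<^sup>2)\<^sup>-\<^sup>m\<close> over \<open>v\<close> is a quotient of negative moments of Gaussian norms in dimensions
  \<open>n - 1\<close> and \<open>n\<close>, and is at most \<open>2\<close>.  By Cauchy-Schwarz the smeared mixture gives an event of Gaussian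
  probability \<open>p\<close> mass at most \<open>sqrt (2 p)\<close> in the limit \<open>\<epsilon> \<rightarrow> 0\<close>; Fatou's lemma on open sets and
  outer regularity transfer this to the mixture of the singular hyperplane Gaussians.
\<close>

subsection \<open>Rotation invariance of the standard Gaussian\<close>

text \<open>The obstacle is singularity: for a fixed v the hyperplane Gaussian has no density
  against N(0,I_n), so there is no likelihood ratio to square. After smearing, the ratio depends on
  each sample x only through the scalar \<open>ip n x v\<close>, and the inner product for v and w
  involves only the correlated pair \<open>ip n x v\<close>, \<open>ip n x w\<close>. As \<epsilon>
  tends to 0 that inner product tends to (1 - <v,w>^2)^(-1/2) per sample when |<v,w>| < 1. The bound
  uses exponent -1 instead, so that m samples give an integer power and the average over v becomes a
  Gamma-type integral; this loss is affordable because m is at most a fixed fraction of n. The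
  numbers fit as follows. Derandomizing the algorithm turns error 1/10 into an event of probability
  at most 1/5 in the Gaussian case and at least 4/5 in every hyperplane case. The second moment
  bound 2 would force 4/5 to be at most sqrt (2/5), which is about 0.63.\<close>

lemma PiM_density:
  assumes I: "finite I" and M: "sigma_finite_measure M" and D: "sigma_finite_measure (density M f)"
    and [measurable]: "f \<in> borel_measurable M"
  shows "PiM I (\<lambda>_. density M f) = density (PiM I (\<lambda>_. M)) (\<lambda>x. \<Prod>i\<in>I. f (x i))"
proof -
  interpret M: product_sigma_finite "\<lambda>_. M" using M by (simp add: product_sigma_finite_def)
  interpret D: product_sigma_finite "\<lambda>_. density M f" using D by (simp add: product_sigma_finite_def)
  have "density (PiM I (\<lambda>_. M)) (\<lambda>x. \<Prod>i\<in>I. f (x i)) = PiM I (\<lambda>_. density M f)"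
  proof (rule D.PiM_eqI[OF I])
    show "sets (density (PiM I (\<lambda>_. M)) (\<lambda>x. \<Prod>i\<in>I. f (x i))) = sets (PiM I (\<lambda>_. density M f))"
      by (simp cong: sets_PiM_cong)
    fix A assume A: "\<And>i. i \<in> I \<Longrightarrow> A i \<in> sets (density M f)"
    then have [measurable]: "\<And>i. i \<in> I \<Longrightarrow> A i \<in> sets M" by simp
    have "emeasure (density (PiM I (\<lambda>_. M)) (\<lambda>x. \<Prod>i\<in>I. f (x i))) (Pi\<^sub>E I A) =
        (\<integral>\<^sup>+x. (\<Prod>i\<in>I. f (x i)) * indicator (Pi\<^sub>E I A) x \<partial>PiM I (\<lambda>_. M))"
      using I by (subst emeasure_density) (auto intro!: sets_PiM_I_finite)
    also have "\<dots> = (\<integral>\<^sup>+x. (\<Prod>i\<in>I. f (x i) * indicator (A i) (x i)) \<partial>PiM I (\<lambda>_. M))"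
    proof (rule nn_integral_cong)
      fix x assume "x \<in> space (PiM I (\<lambda>_. M))"
      then have "indicator (Pi\<^sub>E I A) x = (\<Prod>i\<in>I. indicator (A i) (x i) :: ennreal)"
        using I by (auto simp: space_PiM PiE_iff indicator_def prod_zero_iff)
      then show "(\<Prod>i\<in>I. f (x i)) * indicator (Pi\<^sub>E I A) x = (\<Prod>i\<in>I. f (x i) * indicator (A i) (x i))"
        by (simp add: prod.distrib)
    qed
    also have "\<dots> = (\<Prod>i\<in>I. \<integral>\<^sup>+x. f x * indicator (A i) x \<partial>M)"
      using I by (intro M.product_nn_integral_prod) auto
    also have "\<dots> = (\<Prod>i\<in>I. emeasure (density M f) (A i))"
      by (intro prod.cong) (auto simp: emeasure_density)
    finally show "emeasure (density (PiM I (\<lambda>_. M)) (\<lambda>x. \<Prod>i\<in>I. f (x i))) (Pi\<^sub>E I A) =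
        (\<Prod>i\<in>I. emeasure (density M f) (A i))" .
  qed
  then show ?thesis by simp
qed

text \<open>Supplies the translations of which the shears below are made.\<close>

lemma distr_PiM_lborel_plus:
  fixes b :: "'i \<Rightarrow> real"
  assumes I: "finite I"
  shows "distr (PiM I (\<lambda>_. lborel)) (PiM I (\<lambda>_. lborel)) (\<lambda>x. \<lambda>i\<in>I. x i + b i) = PiM I (\<lambda>_. lborel)"
proof -
  interpret product_sigma_finite "\<lambda>_::'i. lborel :: real measure" by standard
  show ?thesis
  proof (rule PiM_eqI[OF I])
    fix A assume A: "\<And>i. i \<in> I \<Longrightarrow> A i \<in> sets (lborel :: real measure)"
    have A': "(\<lambda>x. x + b i) -` A i \<in> sets borel" if "i \<in> I" for i
      using measurable_sets[of "\<lambda>x. x + b i" borel borel "A i"] A[OF that] by simp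
    have "emeasure (distr (PiM I (\<lambda>_. lborel)) (PiM I (\<lambda>_. lborel)) (\<lambda>x. \<lambda>i\<in>I. x i + b i)) (Pi\<^sub>E I A) =
        emeasure (PiM I (\<lambda>_. lborel)) (Pi\<^sub>E I (\<lambda>i. (\<lambda>x. x + b i) -` A i))"
      using I A by (subst emeasure_distr)
        (auto intro!: sets_PiM_I_finite arg_cong[where f="emeasure _"] simp: space_PiM PiE_iff)
    also have "\<dots> = (\<Prod>i\<in>I. emeasure lborel ((\<lambda>x. x + b i) -` A i))"
      using I A' by (subst emeasure_PiM) auto
    also have "\<dots> = (\<Prod>i\<in>I. emeasure lborel (A i))"
    proof (rule prod.cong)
      fix i assume "i \<in> I"
      then have "emeasure (distr lborel borel (\<lambda>x. b i + x)) (A i) = emeasure lborel ((\<lambda>x. x + b i) -` A i)"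
        using A[of i] by (subst emeasure_distr) (auto intro!: arg_cong[where f="emeasure _"] simp: add.commute)
      then show "emeasure lborel ((\<lambda>x. x + b i) -` A i) = emeasure lborel (A i)"
        by (simp add: lborel_distr_plus)
    qed simp
    finally show "emeasure (distr (PiM I (\<lambda>_. lborel)) (PiM I (\<lambda>_. lborel)) (\<lambda>x. \<lambda>i\<in>I. x i + b i)) (Pi\<^sub>E I A) =
        (\<Prod>i\<in>I. emeasure lborel (A i))" .
  qed simp
qed

section \<open>The standard Gaussian and the inner product on R^n\<close>

abbreviation std_normal :: "real measure" where
  "std_normal \<equiv> density lborel std_normal_density"

interpretation std_normal: prob_space std_normal
  by (rule prob_space_normal_density) simp

lemma sets_std_gaussian [measurable_cong, simp]: "sets (std_gaussian n) = sets (borel_Rn n)"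
  unfolding std_gaussian_def borel_Rn_def by (intro sets_PiM_cong) auto

lemma space_borel_Rn [simp]: "space (borel_Rn n) = Rn n"
  by (simp add: borel_Rn_def Rn_def space_PiM)

lemma space_std_gaussian [simp]: "space (std_gaussian n) = Rn n"
  using sets_eq_imp_space_eq[OF sets_std_gaussian] by simp

lemma prob_space_std_gaussian: "prob_space (std_gaussian n)"
  unfolding std_gaussian_def by (intro prob_space_PiM) (rule std_normal.prob_space_axioms)

interpretation std_gaussian: prob_space "std_gaussian n" for n
  by (rule prob_space_std_gaussian)

definition ip :: "nat \<Rightarrow> (nat \<Rightarrow> real) \<Rightarrow> (nat \<Rightarrow> real) \<Rightarrow> real" where
  "ip n x y = (\<Sum>i<n. x i * y i)"

text \<open>For a unit vector v this keeps the projection of x onto the complement of v and makes s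
  the component along v. With s = 0 it is the orthogonal projection onto the hyperplane; with s an
  independent standard normal it reproduces the Gaussian; with s uniform on
  [-\<epsilon>, \<epsilon>] it is the smeared hyperplane Gaussian.\<close>

definition set_component :: "nat \<Rightarrow> (nat \<Rightarrow> real) \<Rightarrow> real \<Rightarrow> (nat \<Rightarrow> real) \<Rightarrow> nat \<Rightarrow> real" where
  "set_component n v s x = (\<lambda>i\<in>{..<n}. x i + (s - ip n x v) * v i)"

lemma ip_commute: "ip n x y = ip n y x"
  by (simp add: ip_def mult.commute)

lemma ip_nonneg: "ip n x x \<ge> 0"
  by (simp add: ip_def sum_nonneg)

lemma ip_add_left: "ip n (\<lambda>i\<in>{..<n}. x i + c * y i) z = ip n x z + c * ip n y z"
  by (simp add: ip_def ring_distribs sum.distrib sum_distrib_left mult.assoc)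

lemma ip_add_right: "ip n z (\<lambda>i\<in>{..<n}. x i + c * y i) = ip n z x + c * ip n z y"
  by (metis ip_add_left ip_commute)

lemma ip_set_component_left:
  "ip n (set_component n v s x) w = ip n x w + (s - ip n x v) * ip n v w"
  unfolding set_component_def by (rule ip_add_left)

lemma ip_set_component:
  assumes "ip n v v = 1"
  shows "ip n (set_component n v s x) v = s"
  using assms by (simp add: ip_set_component_left)

lemma ip_set_component_self:
  assumes "ip n v v = 1"
  shows "ip n (set_component n v s x) (set_component n v s x) = ip n x x - (ip n x v)\<^sup>2 + s\<^sup>2"
proof -
  have "ip n (set_component n v s x) (set_component n v s x) =
      ip n (set_component n v s x) x + (s - ip n x v) * ip n (set_component n v s x) v"
    by (subst (2) set_component_def) (rule ip_add_right)
  also have "\<dots> = ip n x x - (ip n x v)\<^sup>2 + s\<^sup>2"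
    using assms by (simp add: ip_set_component_left ip_commute[of n v x] algebra_simps power2_eq_square)
  finally show ?thesis .
qed

lemma measurable_Rn_component:
  assumes "f \<in> M \<rightarrow>\<^sub>M borel_Rn n" "i < n"
  shows "(\<lambda>x. f x i) \<in> borel_measurable M"
  using measurable_compose[OF assms(1)[unfolded borel_Rn_def] measurable_component_singleton] assms(2) by simp

lemma measurable_RnI:
  assumes "\<And>i. i < n \<Longrightarrow> (\<lambda>x. f x i) \<in> borel_measurable M"
  shows "(\<lambda>x. \<lambda>i\<in>{..<n}. f x i) \<in> M \<rightarrow>\<^sub>M borel_Rn n"
  unfolding borel_Rn_def using assms by (intro measurable_restrict) auto

lemma measurable_ip [measurable (raw)]:
  assumes "f \<in> M \<rightarrow>\<^sub>M borel_Rn n" "g \<in> M \<rightarrow>\<^sub>M borel_Rn n"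
  shows "(\<lambda>x. ip n (f x) (g x)) \<in> borel_measurable M"
  unfolding ip_def using assms
  by (intro borel_measurable_sum borel_measurable_times measurable_Rn_component) auto

lemma measurable_ip_const [measurable (raw)]:
  assumes "f \<in> M \<rightarrow>\<^sub>M borel_Rn n"
  shows "(\<lambda>x. ip n (f x) v) \<in> borel_measurable M"
  unfolding ip_def using measurable_Rn_component[OF assms]
  by (intro borel_measurable_sum borel_measurable_times borel_measurable_const) auto

lemma measurable_Rn_add_mult [measurable (raw)]:
  assumes "f \<in> M \<rightarrow>\<^sub>M borel_Rn n" "s \<in> borel_measurable M"
  shows "(\<lambda>x. \<lambda>i\<in>{..<n}. f x i + s x * v i) \<in> M \<rightarrow>\<^sub>M borel_Rn n"
  using assms measurable_Rn_component[OF assms(1)]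
  by (intro measurable_RnI borel_measurable_add borel_measurable_times borel_measurable_const)

lemma measurable_set_component [measurable (raw)]:
  assumes [measurable]: "f \<in> M \<rightarrow>\<^sub>M borel_Rn n" "s \<in> borel_measurable M"
  shows "(\<lambda>x. set_component n v (s x) (f x)) \<in> M \<rightarrow>\<^sub>M borel_Rn n"
  unfolding set_component_def by measurable

lemma std_gaussian_eq_density:
  "std_gaussian n = density (PiM {..<n} (\<lambda>_. lborel)) (\<lambda>x. ennreal ((1 / sqrt (2 * pi)) ^ n * exp (- ip n x x / 2)))"
proof -
  have "(\<Prod>i<n. ennreal (std_normal_density (x i))) = ennreal ((1 / sqrt (2 * pi)) ^ n * exp (- ip n x x / 2))" for x
    by (subst prod_ennreal)
       (auto simp: std_normal_density_def prod.distrib exp_sum[symmetric] ip_def sum_negf sum_divide_distrib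
          power2_eq_square prod_dividef power_divide)
  then show ?thesis
    unfolding std_gaussian_def
    by (subst PiM_density) (auto intro: std_normal.sigma_finite_measure lborel.sigma_finite_measure_axioms)
qed

lemma nn_integral_PiM_lborel_shift:
  assumes "f \<in> borel_measurable (borel_Rn n)"
  shows "(\<integral>\<^sup>+x. f (\<lambda>i\<in>{..<n}. x i + s * v i) \<partial>PiM {..<n} (\<lambda>_. lborel)) = (\<integral>\<^sup>+x. f x \<partial>PiM {..<n} (\<lambda>_. lborel))"
proof -
  have sets: "sets (PiM {..<n} (\<lambda>_. lborel)) = sets (borel_Rn n)"
    unfolding borel_Rn_def by (intro sets_PiM_cong) auto
  have f: "f \<in> borel_measurable (PiM {..<n} (\<lambda>_. lborel))"
    using assms by (simp add: measurable_cong_sets[OF sets])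
  have "(\<lambda>x. \<lambda>i\<in>{..<n}. x i + s * v i) \<in> PiM {..<n} (\<lambda>_. lborel) \<rightarrow>\<^sub>M PiM {..<n} (\<lambda>_. lborel)"
    unfolding measurable_cong_sets[OF sets sets] by measurable
  from nn_integral_distr[OF this, of f] f show ?thesis
    by (simp add: distr_PiM_lborel_plus)
qed

text \<open>
  The map \<open>(x, s) \<mapsto> (set_component n v s x, - \<langle>x, v\<rangle>)\<close> is a rotation of \<open>\<real>\<^sup>n \<times> \<real>\<close>.  It is the
  composition of three shears, each of which preserves Lebesgue measure by Fubini and translation invariance.
\<close>

lemma distr_set_component_std_gaussian:
  assumes v: "ip n v v = 1"
  shows "distr (std_gaussian n \<Otimes>\<^sub>M std_normal) (borel_Rn n) (\<lambda>(x, s). set_component n v s x) = std_gaussian n"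
proof (rule measure_eqI)
  let ?L = "PiM {..<n} (\<lambda>_. lborel) :: (nat \<Rightarrow> real) measure"
  interpret L: product_sigma_finite "\<lambda>_::nat. lborel :: real measure" by standard
  interpret L: sigma_finite_measure ?L by (rule L.sigma_finite) simp
  interpret P: pair_sigma_finite ?L lborel by standard
  have sL[measurable_cong]: "sets ?L = sets (borel_Rn n)"
    unfolding borel_Rn_def by (intro sets_PiM_cong) auto
  fix A assume "A \<in> sets (distr (std_gaussian n \<Otimes>\<^sub>M std_normal) (borel_Rn n) (\<lambda>(x, s). set_component n v s x))"
  then have A[measurable]: "A \<in> sets (borel_Rn n)" by simp
  define e where "e x s = ennreal ((1 / sqrt (2 * pi)) ^ n * exp (- ip n x x / 2)) * ennreal (std_normal_density s)"
    for x :: "nat \<Rightarrow> real" and s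
  define H where "H x s = indicator A x * e x s" for x s
  define T where "T c x = (\<lambda>i\<in>{..<n}. x i + c * v i)" for c and x :: "nat \<Rightarrow> real"
  have [measurable]: "(\<lambda>(x, s). e x s) \<in> borel_measurable (borel_Rn n \<Otimes>\<^sub>M borel)"
    unfolding e_def by measurable
  have [measurable]: "(\<lambda>(x, s). H x s) \<in> borel_measurable (borel_Rn n \<Otimes>\<^sub>M borel)"
    unfolding H_def by measurable
  have T[measurable]: "f \<in> M \<rightarrow>\<^sub>M borel_Rn n \<Longrightarrow> s \<in> borel_measurable M \<Longrightarrow> (\<lambda>x. T (s x) (f x)) \<in> M \<rightarrow>\<^sub>M borel_Rn n"
    for f s and M :: "'c measure"
    unfolding T_def by measurable
  \<comment> \<open>The shears in order: x gains s v, then s loses the inner product of the new x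
    with v, then x gains the new s times v. \<open>T2\<close> says that the new s is the negated old
    component of x.\<close>
  have T1: "T (s - ip n (T s x) v) (T s x) = set_component n v s x" for s x
    using v by (auto simp: T_def set_component_def ip_add_left fun_eq_iff algebra_simps)
  have T2: "s - ip n (T s x) v = - ip n x v" for s x
    using v by (simp add: T_def ip_add_left)
  \<comment> \<open>The map preserves |x|^2 + s^2, hence the joint Gaussian density.\<close>
  have e: "e x s = e (set_component n v s x) (- ip n x v)" for x s
    by (simp add: e_def std_normal_density_def ip_set_component_self[OF v] mult_exp_exp field_simps
        flip: ennreal_mult)
  \<comment> \<open>With the x-integral inside, s is fixed and the shear in x is a translation. Both
    x-shears use a = 1, hence the factors \<open>1 * s\<close> below; the middle shear translates s
    for fixed x.\<close>
  have step: "(\<integral>\<^sup>+s. \<integral>\<^sup>+x. F (T (a * s) x) s \<partial>?L \<partial>lborel) = (\<integral>\<^sup>+x. \<integral>\<^sup>+s. F x s \<partial>lborel \<partial>?L)"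
    if [measurable]: "(\<lambda>(x, s). F x s) \<in> borel_measurable (borel_Rn n \<Otimes>\<^sub>M borel)" for F :: "_ \<Rightarrow> _ \<Rightarrow> ennreal" and a
  proof -
    have "(\<integral>\<^sup>+s. \<integral>\<^sup>+x. F (T (a * s) x) s \<partial>?L \<partial>lborel) = (\<integral>\<^sup>+s. \<integral>\<^sup>+x. F x s \<partial>?L \<partial>lborel)"
      unfolding T_def by (intro nn_integral_cong nn_integral_PiM_lborel_shift) measurable
    also have "\<dots> = (\<integral>\<^sup>+x. \<integral>\<^sup>+s. F x s \<partial>lborel \<partial>?L)"
      by (rule P.Fubini') measurable
    finally show ?thesis .
  qed
  have dens: "(\<integral>\<^sup>+x. \<integral>\<^sup>+s. F x s \<partial>std_normal \<partial>std_gaussian n) = (\<integral>\<^sup>+x. \<integral>\<^sup>+s. F x s * e x s \<partial>lborel \<partial>?L)"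
    if [measurable]: "(\<lambda>(x, s). F x s) \<in> borel_measurable (borel_Rn n \<Otimes>\<^sub>M borel)" for F :: "_ \<Rightarrow> _ \<Rightarrow> ennreal"
  proof -
    have "(\<integral>\<^sup>+x. \<integral>\<^sup>+s. F x s \<partial>std_normal \<partial>std_gaussian n) =
        (\<integral>\<^sup>+x. ennreal ((1 / sqrt (2 * pi)) ^ n * exp (- ip n x x / 2)) *
          (\<integral>\<^sup>+s. ennreal (std_normal_density s) * F x s \<partial>lborel) \<partial>?L)"
      unfolding std_gaussian_eq_density
      by (subst nn_integral_density)
         (auto intro!: nn_integral_cong arg_cong2[where f="(*)"] nn_integral_density simp: sets_eq_imp_space_eq[OF sL])
    also have "\<dots> = (\<integral>\<^sup>+x. \<integral>\<^sup>+s. F x s * e x s \<partial>lborel \<partial>?L)"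
      unfolding e_def by (intro nn_integral_cong, subst nn_integral_cmult[symmetric])
        (auto intro!: nn_integral_cong simp: mult_ac sets_eq_imp_space_eq[OF sL])
    finally show ?thesis .
  qed
  have "emeasure (distr (std_gaussian n \<Otimes>\<^sub>M std_normal) (borel_Rn n) (\<lambda>(x, s). set_component n v s x)) A =
      (\<integral>\<^sup>+z. indicator A (set_component n v (snd z) (fst z)) \<partial>(std_gaussian n \<Otimes>\<^sub>M std_normal))"
    by (subst nn_integral_indicator[symmetric])
       (auto simp: nn_integral_distr case_prod_beta simp del: nn_integral_indicator)
  also have "\<dots> = (\<integral>\<^sup>+x. \<integral>\<^sup>+s. indicator A (set_component n v s x) \<partial>std_normal \<partial>std_gaussian n)"
    by (subst std_normal.nn_integral_fst[symmetric]) auto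
  also have "\<dots> = (\<integral>\<^sup>+x. \<integral>\<^sup>+s. indicator A (set_component n v s x) * e x s \<partial>lborel \<partial>?L)"
    by (rule dens) measurable
  also have "\<dots> = (\<integral>\<^sup>+x. \<integral>\<^sup>+s. H (T (s - ip n (T s x) v) (T s x)) (s - ip n (T s x) v) \<partial>lborel \<partial>?L)"
    unfolding T1 unfolding T2 H_def e[symmetric] by (rule refl)
  also have "\<dots> = (\<integral>\<^sup>+s. \<integral>\<^sup>+x. H (T (s - ip n (T (1 * s) x) v) (T (1 * s) x)) (s - ip n (T (1 * s) x) v) \<partial>?L \<partial>lborel)"
    by (subst P.Fubini') auto
  also have "\<dots> = (\<integral>\<^sup>+x. \<integral>\<^sup>+s. H (T (s - ip n x v) x) (s - ip n x v) \<partial>lborel \<partial>?L)"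
    by (rule step) measurable
  also have "\<dots> = (\<integral>\<^sup>+x. \<integral>\<^sup>+s. H (T s x) s \<partial>lborel \<partial>?L)"
  proof (rule nn_integral_cong)
    fix x assume "x \<in> space ?L"
    then have [measurable]: "x \<in> space (borel_Rn n)" using sets_eq_imp_space_eq[OF sL] by simp
    show "(\<integral>\<^sup>+s. H (T (s - ip n x v) x) (s - ip n x v) \<partial>lborel) = (\<integral>\<^sup>+s. H (T s x) s \<partial>lborel)"
      by (subst (2) nn_integral_real_affine[where c=1 and t="- ip n x v"]) auto
  qed
  also have "\<dots> = (\<integral>\<^sup>+s. \<integral>\<^sup>+x. H (T (1 * s) x) s \<partial>?L \<partial>lborel)"
    by (subst P.Fubini') auto
  also have "\<dots> = (\<integral>\<^sup>+x. \<integral>\<^sup>+s. H x s \<partial>lborel \<partial>?L)"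
    by (rule step) measurable
  also have "\<dots> = (\<integral>\<^sup>+x. \<integral>\<^sup>+s. indicator A x \<partial>std_normal \<partial>std_gaussian n)"
    unfolding H_def by (rule dens[symmetric]) measurable
  also have "\<dots> = emeasure (std_gaussian n) A"
    by (simp add: std_normal.emeasure_space_1[simplified])
  finally show "emeasure (distr (std_gaussian n \<Otimes>\<^sub>M std_normal) (borel_Rn n) (\<lambda>(x, s). set_component n v s x)) A =
      emeasure (std_gaussian n) A" .
qed simp

subsection \<open>Smeared hyperplane Gaussians\<close>

text \<open>Rotation invariance as an iterated integral: the component along v may be resampled
  independently of the rest. The s-integral is outside, so any factor depending only on that
  component leaves the inner integral.\<close>

lemma nn_integral_std_gaussian_set_component:
  assumes v: "ip n v v = 1" and [measurable]: "f \<in> borel_measurable (borel_Rn n)"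
  shows "(\<integral>\<^sup>+x. f x \<partial>std_gaussian n) = (\<integral>\<^sup>+s. \<integral>\<^sup>+x. f (set_component n v s x) \<partial>std_gaussian n \<partial>std_normal)"
proof -
  interpret P: pair_sigma_finite "std_gaussian n" std_normal by standard
  show ?thesis
    by (subst distr_set_component_std_gaussian[OF v, symmetric], subst nn_integral_distr)
       (auto simp: case_prod_beta P.nn_integral_snd[symmetric])
qed

lemma nn_integral_std_gaussian_ip:
  assumes v: "ip n v v = 1" and [measurable]: "f \<in> borel_measurable borel"
  shows "(\<integral>\<^sup>+x. f (ip n x v) \<partial>std_gaussian n) = (\<integral>\<^sup>+s. f s \<partial>std_normal)"
  by (subst nn_integral_std_gaussian_set_component[OF v])
     (auto simp: ip_set_component[OF v] std_gaussian.emeasure_space_1[simplified])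

text \<open>The noise lives on the fixed interval [-1, 1] and is scaled by \<epsilon> afterwards.
  All smearing levels, including 0, then share one probability space, where they converge
  pointwise.\<close>

definition unif :: "real measure" where
  "unif = uniform_measure lborel {-1..1}"

lemma sets_unif [measurable_cong, simp]: "sets unif = sets borel"
  by (simp add: unif_def)

lemma space_unif [simp]: "space unif = UNIV"
  by (simp add: unif_def)

lemma prob_space_unif: "prob_space unif"
  unfolding unif_def by (rule prob_space_uniform_measure) auto

interpretation unif: prob_space unif
  by (rule prob_space_unif)

text \<open>The density of the uniform distribution on \<open>[-\<epsilon>, \<epsilon>]\<close> with respect to the standard normal one.\<close>

definition slab_weight :: "real \<Rightarrow> real \<Rightarrow> ennreal" where
  "slab_weight \<epsilon> a = ennreal (1 / (2 * \<epsilon> * std_normal_density a)) * indicator {-\<epsilon>..\<epsilon>} a"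

lemma measurable_slab_weight [measurable]: "slab_weight \<epsilon> \<in> borel_measurable borel"
  unfolding slab_weight_def[abs_def] by measurable

lemma nn_integral_unif_scale:
  assumes e: "\<epsilon> > 0" and [measurable]: "f \<in> borel_measurable borel"
  shows "(\<integral>\<^sup>+s. f (\<epsilon> * s) \<partial>unif) = (\<integral>\<^sup>+s. slab_weight \<epsilon> s * f s \<partial>std_normal)"
proof -
  have ind: "indicator {-\<epsilon>..\<epsilon>} (\<epsilon> * s) = (indicator {-1..1} s :: ennreal)" for s
    using e mult_le_cancel_left_pos[OF e, of "-1" s] mult_le_cancel_left_pos[OF e, of s 1]
    by (simp add: indicator_def)
  have "(\<integral>\<^sup>+s. slab_weight \<epsilon> s * f s \<partial>std_normal) = (\<integral>\<^sup>+s. ennreal (1 / (2 * \<epsilon>)) * (indicator {-\<epsilon>..\<epsilon>} s * f s) \<partial>lborel)"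
  proof (subst nn_integral_density; (auto intro!: nn_integral_cong)?)
    fix s
    have "ennreal (std_normal_density s) * slab_weight \<epsilon> s =
        ennreal (std_normal_density s * (1 / (2 * \<epsilon> * std_normal_density s))) * indicator {-\<epsilon>..\<epsilon>} s"
      using e by (subst ennreal_mult) (auto simp: slab_weight_def mult.assoc)
    also have "std_normal_density s * (1 / (2 * \<epsilon> * std_normal_density s)) = 1 / (2 * \<epsilon>)"
      using normal_density_pos[of 1 0 s] by simp
    finally show "ennreal (std_normal_density s) * (slab_weight \<epsilon> s * f s) = ennreal (1 / (2 * \<epsilon>)) * (indicator {-\<epsilon>..\<epsilon>} s * f s)"
      by (simp add: mult.assoc[symmetric])
  qed
  also have "\<dots> = ennreal (1 / (2 * \<epsilon>)) * (\<integral>\<^sup>+s. indicator {-\<epsilon>..\<epsilon>} s * f s \<partial>lborel)"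
    by (rule nn_integral_cmult) auto
  also have "\<dots> = ennreal (1 / (2 * \<epsilon>)) * (ennreal \<epsilon> * (\<integral>\<^sup>+s. f (\<epsilon> * s) * indicator {-1..1} s \<partial>lborel))"
    using e by (subst nn_integral_real_affine[where c=\<epsilon> and t=0])
      (auto intro!: arg_cong2[where f="(*)"] nn_integral_cong simp: ind mult.commute[of _ "f _"])
  also have "\<dots> = (\<integral>\<^sup>+s. f (\<epsilon> * s) * indicator {-1..1} s \<partial>lborel) / 2"
    using e by (simp add: mult.assoc[symmetric] ennreal_mult[symmetric] divide_ennreal_def mult.commute
      ennreal_divide_numeral[symmetric] inverse_eq_divide flip: inverse_ennreal)
  also have "\<dots> = (\<integral>\<^sup>+s. f (\<epsilon> * s) \<partial>unif)"
    unfolding unif_def by (subst nn_integral_uniform_measure) auto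
  finally show ?thesis by simp
qed

text \<open>Smearing changes only the law of the component along v, from standard normal to uniform
  on [-\<epsilon>, \<epsilon>], and that component is independent of the rest. The likelihood ratio
  is therefore a function of \<open>ip n x v\<close> alone.\<close>

lemma distr_set_component_unif:
  assumes v: "ip n v v = 1" and e: "\<epsilon> > 0"
  shows "distr (std_gaussian n \<Otimes>\<^sub>M unif) (borel_Rn n) (\<lambda>(x, s). set_component n v (\<epsilon> * s) x) =
    density (std_gaussian n) (\<lambda>x. slab_weight \<epsilon> (ip n x v))"
proof (rule measure_eqI)
  interpret P: pair_sigma_finite "std_gaussian n" std_normal by standard
  fix A assume "A \<in> sets (distr (std_gaussian n \<Otimes>\<^sub>M unif) (borel_Rn n) (\<lambda>(x, s). set_component n v (\<epsilon> * s) x))"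
  then have [measurable]: "A \<in> sets (borel_Rn n)" by simp
  have "emeasure (density (std_gaussian n) (\<lambda>x. slab_weight \<epsilon> (ip n x v))) A =
      (\<integral>\<^sup>+s. \<integral>\<^sup>+x. slab_weight \<epsilon> s * indicator A (set_component n v s x) \<partial>std_gaussian n \<partial>std_normal)"
    by (subst emeasure_density; (subst nn_integral_std_gaussian_set_component[OF v])?) (auto simp: ip_set_component[OF v])
  also have "\<dots> = (\<integral>\<^sup>+x. \<integral>\<^sup>+s. slab_weight \<epsilon> s * indicator A (set_component n v s x) \<partial>std_normal \<partial>std_gaussian n)"
    by (rule P.Fubini') measurable
  also have "\<dots> = (\<integral>\<^sup>+x. \<integral>\<^sup>+s. indicator A (set_component n v (\<epsilon> * s) x) \<partial>unif \<partial>std_gaussian n)"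
    by (intro nn_integral_cong nn_integral_unif_scale[OF e, symmetric]) auto
  also have "\<dots> = (\<integral>\<^sup>+z. indicator A (set_component n v (\<epsilon> * snd z) (fst z)) \<partial>(std_gaussian n \<Otimes>\<^sub>M unif))"
    by (subst unif.nn_integral_fst[symmetric]) auto
  also have "\<dots> = emeasure (distr (std_gaussian n \<Otimes>\<^sub>M unif) (borel_Rn n) (\<lambda>(x, s). set_component n v (\<epsilon> * s) x)) A"
    by (subst nn_integral_indicator[of A, symmetric])
       (auto simp: nn_integral_distr case_prod_beta simp del: nn_integral_indicator)
  finally show "emeasure (distr (std_gaussian n \<Otimes>\<^sub>M unif) (borel_Rn n) (\<lambda>(x, s). set_component n v (\<epsilon> * s) x)) A =
      emeasure (density (std_gaussian n) (\<lambda>x. slab_weight \<epsilon> (ip n x v))) A" by simp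
qed simp

text \<open>Cauchy-Schwarz, read off from the nonnegative squared norm of the projection of v onto
  the complement of w.\<close>

lemma ip_sq_le_1:
  assumes "ip n v v = 1" "ip n w w = 1"
  shows "(ip n v w)\<^sup>2 \<le> 1"
  using ip_set_component_self[OF assms(2), of 0 v] ip_nonneg[of n "set_component n w 0 v"] assms by simp

text \<open>Write a for \<sigma> t + b. Where the weight is nonzero, |a| is at most \<epsilon>, so
  the quotient of the normal densities at t and at a, which is exp ((a^2 - t^2) / 2), is at most exp
  (\<epsilon>^2 / 2). The admissible t form an interval of length 2 \<epsilon> / \<sigma>.\<close>

lemma nn_integral_slab_weight_affine:
  assumes e: "\<epsilon> > 0" and c: "\<sigma> > 0"
  shows "(\<integral>\<^sup>+t. slab_weight \<epsilon> (\<sigma> * t + b) \<partial>std_normal) \<le> ennreal (exp (\<epsilon>\<^sup>2 / 2) / \<sigma>)"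
proof -
  have "(\<integral>\<^sup>+t. slab_weight \<epsilon> (\<sigma> * t + b) \<partial>std_normal) =
      (\<integral>\<^sup>+t. ennreal (std_normal_density t) * slab_weight \<epsilon> (\<sigma> * t + b) \<partial>lborel)"
    by (rule nn_integral_density) auto
  also have "\<dots> \<le> (\<integral>\<^sup>+t. ennreal (exp (\<epsilon>\<^sup>2 / 2) / (2 * \<epsilon>)) * indicator {(-\<epsilon> - b) / \<sigma>..(\<epsilon> - b) / \<sigma>} t \<partial>lborel)"
  proof (rule nn_integral_mono)
    fix t :: real
    define a where "a = \<sigma> * t + b"
    show "ennreal (std_normal_density t) * slab_weight \<epsilon> (\<sigma> * t + b)
        \<le> ennreal (exp (\<epsilon>\<^sup>2 / 2) / (2 * \<epsilon>)) * indicator {(-\<epsilon> - b) / \<sigma>..(\<epsilon> - b) / \<sigma>} t"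
    proof (cases "a \<in> {-\<epsilon>..\<epsilon>}")
      case True
      then have "a\<^sup>2 \<le> \<epsilon>\<^sup>2" by (simp add: abs_le_square_iff[symmetric] abs_le_iff)
      then have "std_normal_density t * (1 / (2 * \<epsilon> * std_normal_density a)) \<le> exp (\<epsilon>\<^sup>2 / 2) / (2 * \<epsilon>)"
        using e by (simp add: std_normal_density_def field_simps mult_exp_exp[symmetric] flip: exp_add)
          (simp add: add_increasing2)
      moreover have "t \<in> {(-\<epsilon> - b) / \<sigma>..(\<epsilon> - b) / \<sigma>}"
        using True c by (auto simp: a_def field_simps)
      ultimately show ?thesis
        using e True by (simp add: slab_weight_def a_def[symmetric] flip: ennreal_mult)
    next
      case False
      then show ?thesis by (simp add: slab_weight_def a_def[symmetric])
    qed
  qed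
  also have "\<dots> = ennreal (exp (\<epsilon>\<^sup>2 / 2) / (2 * \<epsilon>)) * ennreal (2 * \<epsilon> / \<sigma>)"
    using e c by (subst nn_integral_cmult_indicator) (auto simp: diff_divide_distrib[symmetric] divide_right_mono)
  also have "\<dots> = ennreal (exp (\<epsilon>\<^sup>2 / 2) / \<sigma>)"
    using e c by (subst ennreal_mult[symmetric]) auto
  finally show ?thesis .
qed

lemma nn_integral_slab_weight:
  assumes "\<epsilon> > 0"
  shows "(\<integral>\<^sup>+s. slab_weight \<epsilon> s \<partial>std_normal) = 1"
  using nn_integral_unif_scale[OF assms, of "\<lambda>_. 1"] by (simp add: unif.emeasure_space_1[simplified])

text \<open>Given \<open>ip n x v = s\<close>, the other component is
  \<open>ip n x w = \<sigma> * t + s * r\<close>, where t is an independent standard normal, r =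
  <v,w> and \<sigma> = sqrt (1 - r^2). Integrating t first gives at most exp (\<epsilon>^2 / 2) /
  \<sigma>, uniformly in s, and the remaining weight in s has integral 1.\<close>

lemma nn_integral_slab_weight_product_le:
  assumes v: "ip n v v = 1" and w: "ip n w w = 1" and e: "\<epsilon> > 0"
  shows "(\<integral>\<^sup>+x. slab_weight \<epsilon> (ip n x v) * slab_weight \<epsilon> (ip n x w) \<partial>std_gaussian n)
    \<le> ennreal (exp (\<epsilon>\<^sup>2 / 2)) * inverse (ennreal (1 - (ip n v w)\<^sup>2))"
proof (cases "(ip n v w)\<^sup>2 = 1")
  \<comment> \<open>Here the right-hand side is infinite, because the inverse of 0 is.\<close>
  case True
  then show ?thesis by (simp add: ennreal_mult_top)
next
  case False
  define r where "r = ip n v w"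
  define \<sigma> where "\<sigma> = sqrt (1 - r\<^sup>2)"
  \<comment> \<open>u is the part of w orthogonal to v, of squared length 1 - r^2, and
    \<open>u'\<close> is its unit vector. The summand 0 in \<open>u'\<close> gives it the shape that
    \<open>ip_add_right\<close> expects.\<close>
  define u where "u = (\<lambda>i\<in>{..<n}. w i + (- r) * v i)"
  define u' where "u' = (\<lambda>i\<in>{..<n}. 0 + (1 / \<sigma>) * u i)"
  have r: "r\<^sup>2 < 1" using False ip_sq_le_1[OF v w] by (simp add: r_def)
  have s: "\<sigma> > 0" "\<sigma>\<^sup>2 = 1 - r\<^sup>2" "\<sigma> \<le> 1" using r by (auto simp: \<sigma>_def)
  have wu: "ip n w u = 1 - r\<^sup>2"
    unfolding u_def by (subst ip_add_right) (simp add: w ip_commute[of n w v] r_def power2_eq_square)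
  have vu: "ip n v u = 0"
    unfolding u_def by (subst ip_add_right) (simp add: v r_def)
  have uu: "ip n u u = 1 - r\<^sup>2"
    by (subst (1) u_def, subst ip_add_left) (simp add: wu vu)
  have ip0: "ip n (\<lambda>i. 0) z = 0" for z by (simp add: ip_def)
  have u': "ip n z u' = ip n z u / \<sigma>" for z
    unfolding u'_def by (subst ip_add_right) (simp add: ip_commute[of n z "\<lambda>_. 0"] ip0)
  have u'u': "ip n u' u' = 1"
  proof -
    have "ip n u' u' = (1 - r\<^sup>2) / \<sigma>\<^sup>2"
      by (simp add: u' ip_commute[of n u' u] uu power2_eq_square[of \<sigma>])
    then show ?thesis using s r by simp
  qed
  have *: "ip n (set_component n v s x) w = \<sigma> * ip n x u' + s * r" for s x
  proof -
    have "ip n x u = ip n x w + (- r) * ip n x v"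
      unfolding u_def by (rule ip_add_right)
    then show ?thesis
      using s(1) by (simp add: u' ip_set_component_left r_def algebra_simps)
  qed
  have "(\<integral>\<^sup>+x. slab_weight \<epsilon> (ip n x v) * slab_weight \<epsilon> (ip n x w) \<partial>std_gaussian n) =
      (\<integral>\<^sup>+s. \<integral>\<^sup>+x. slab_weight \<epsilon> s * slab_weight \<epsilon> (\<sigma> * ip n x u' + s * r) \<partial>std_gaussian n \<partial>std_normal)"
    by (subst nn_integral_std_gaussian_set_component[OF v]) (auto simp: * ip_set_component[OF v])
  also have "\<dots> = (\<integral>\<^sup>+s. slab_weight \<epsilon> s * (\<integral>\<^sup>+t. slab_weight \<epsilon> (\<sigma> * t + s * r) \<partial>std_normal) \<partial>std_normal)"
    by (intro nn_integral_cong, subst nn_integral_cmult, measurable)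
       (intro arg_cong2[where f="(*)"] refl nn_integral_std_gaussian_ip[OF u'u'], measurable)
  also have "\<dots> \<le> (\<integral>\<^sup>+s. slab_weight \<epsilon> s * ennreal (exp (\<epsilon>\<^sup>2 / 2) / \<sigma>) \<partial>std_normal)"
    by (intro nn_integral_mono mult_left_mono nn_integral_slab_weight_affine[OF e s(1)]) auto
  also have "\<dots> = ennreal (exp (\<epsilon>\<^sup>2 / 2) / \<sigma>)"
    by (subst nn_integral_multc) (auto simp: nn_integral_slab_weight[OF e])
  \<comment> \<open>Replacing 1 / \<sigma> by the larger 1 / \<sigma>^2 removes the square root, so
    that later only integer powers occur.\<close>
  also have "\<dots> \<le> ennreal (exp (\<epsilon>\<^sup>2 / 2) / (1 - r\<^sup>2))"
  proof (intro ennreal_leI divide_left_mono)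
    show "1 - r\<^sup>2 \<le> \<sigma>"
      using mult_left_le[of \<sigma> \<sigma>] s(1,3) unfolding s(2)[symmetric] by (simp add: power2_eq_square)
  qed (use s r in auto)
  also have "\<dots> = ennreal (exp (\<epsilon>\<^sup>2 / 2)) * inverse (ennreal (1 - r\<^sup>2))"
    using r unfolding divide_inverse by (subst ennreal_mult) (auto simp: inverse_ennreal)
  finally show ?thesis by (simp add: r_def)
qed

subsection \<open>Negative moments of Gaussian norms\<close>

text \<open>The Laplace transform at t of the square of a standard normal. It is also the standard
  deviation of the normal law obtained by tilting the standard one with exp (- t s^2).\<close>

definition shrink :: "real \<Rightarrow> real" where
  "shrink t = 1 / sqrt (1 + 2 * t)"

lemma measurable_shrink [measurable]: "shrink \<in> borel_measurable borel"
  unfolding shrink_def[abs_def] by measurable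

lemma shrink_pos: "t \<ge> 0 \<Longrightarrow> shrink t > 0"
  by (simp add: shrink_def)

lemma shrink_le_1: "t \<ge> 0 \<Longrightarrow> shrink t \<le> 1"
  by (simp add: shrink_def)

lemma shrink_sq: "t \<ge> 0 \<Longrightarrow> (shrink t)\<^sup>2 * (1 + 2 * t) = 1"
  by (simp add: shrink_def power_divide)

text \<open>Recovers one missing power of \<open>shrink t\<close> at the price of a factor 1 + t;
  this is how dimension n - 1 is compared with dimension n.\<close>

lemma shrink_mult_le: "t \<ge> 0 \<Longrightarrow> 1 \<le> shrink t * (1 + t)"
proof -
  assume t: "t \<ge> 0"
  have "sqrt (1 + 2 * t) \<le> 1 + t"
    using t by (intro real_le_lsqrt) (auto simp: power2_eq_square algebra_simps)
  then show ?thesis using t by (simp add: shrink_def field_simps)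
qed

lemma nn_integral_std_normal_exp_sq:
  assumes t: "t \<ge> 0"
  shows "(\<integral>\<^sup>+s. ennreal (exp (- t * s\<^sup>2)) \<partial>std_normal) = ennreal (shrink t)"
proof -
  have k: "shrink t > 0" using shrink_pos[OF t] .
  have eq: "std_normal_density s * exp (- t * s\<^sup>2) = shrink t * normal_density 0 (shrink t) s" for s
  proof -
    have "1 / (shrink t)\<^sup>2 = 1 + 2 * t"
      using shrink_sq[OF t] k by (simp add: field_simps)
    moreover have "- s\<^sup>2 / (2 * (shrink t)\<^sup>2) = - (s\<^sup>2 / 2) * (1 / (shrink t)\<^sup>2)"
      by simp
    ultimately have "- s\<^sup>2 / (2 * (shrink t)\<^sup>2) = - (s\<^sup>2 / 2) + - t * s\<^sup>2"
      by (simp add: algebra_simps)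
    then show ?thesis
      using k by (simp add: normal_density_def std_normal_density_def real_sqrt_mult mult_exp_exp exp_add)
  qed
  have "(\<integral>\<^sup>+s. ennreal (exp (- t * s\<^sup>2)) \<partial>std_normal) = (\<integral>\<^sup>+s. ennreal (std_normal_density s) * ennreal (exp (- t * s\<^sup>2)) \<partial>lborel)"
    by (rule nn_integral_density) auto
  also have "\<dots> = (\<integral>\<^sup>+s. ennreal (shrink t) * ennreal (normal_density 0 (shrink t) s) \<partial>lborel)"
    using k by (intro nn_integral_cong) (simp add: ennreal_mult[symmetric] eq[simplified])
  also have "\<dots> = ennreal (shrink t) * (\<integral>\<^sup>+s. ennreal (normal_density 0 (shrink t) s) \<partial>lborel)"
    by (rule nn_integral_cmult) auto
  also have "(\<integral>\<^sup>+s. ennreal (normal_density 0 (shrink t) s) \<partial>lborel) = 1"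
    using k by (subst nn_integral_eq_integral) auto
  finally show ?thesis by simp
qed

lemma nn_integral_std_gaussian_exp_norm_sq:
  assumes t: "t \<ge> 0"
  shows "(\<integral>\<^sup>+x. ennreal (exp (- t * ip n x x)) \<partial>std_gaussian n) = ennreal (shrink t ^ n)"
proof -
  interpret N: product_sigma_finite "\<lambda>_. std_normal" by standard
  have "(\<integral>\<^sup>+x. ennreal (exp (- t * ip n x x)) \<partial>std_gaussian n) =
      (\<integral>\<^sup>+x. (\<Prod>i<n. ennreal (exp (- t * (x i)\<^sup>2))) \<partial>std_gaussian n)"
    by (intro nn_integral_cong, subst prod_ennreal)
       (auto simp: exp_sum[symmetric] ip_def sum_distrib_left sum_negf power2_eq_square)
  also have "\<dots> = (\<Prod>i<n. \<integral>\<^sup>+s. ennreal (exp (- t * s\<^sup>2)) \<partial>std_normal)"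
    unfolding std_gaussian_def by (rule N.product_nn_integral_prod) auto
  also have "\<dots> = ennreal (shrink t) ^ n"
    by (subst nn_integral_std_normal_exp_sq[OF t]) simp
  finally show ?thesis
    using shrink_pos[OF t] by (simp add: ennreal_power)
qed

text \<open>No basis of the hyperplane is chosen. The squared norm is the squared norm of the
  projection plus an independent squared normal, so the known transform in dimension n factors as
  \<open>shrink t\<close> times the unknown one, and the positive finite factor cancels.\<close>

lemma nn_integral_std_gaussian_exp_proj_norm_sq:
  assumes t: "t \<ge> 0" and v: "ip n v v = 1"
  shows "(\<integral>\<^sup>+x. ennreal (exp (- t * (ip n x x - (ip n x v)\<^sup>2))) \<partial>std_gaussian n) = ennreal (shrink t ^ (n - 1))"
proof -
  let ?E = "\<integral>\<^sup>+x. ennreal (exp (- t * (ip n x x - (ip n x v)\<^sup>2))) \<partial>std_gaussian n"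
  have k: "shrink t > 0" using shrink_pos[OF t] .
  \<comment> \<open>There is no unit vector for n = 0, so n - 1 is a true subtraction.\<close>
  have n: "n > 0" using v by (cases n) (auto simp: ip_def)
  have "ennreal (shrink t ^ n) = (\<integral>\<^sup>+s. \<integral>\<^sup>+x. ennreal (exp (- t * (ip n x x - (ip n x v)\<^sup>2 + s\<^sup>2))) \<partial>std_gaussian n \<partial>std_normal)"
    by (subst nn_integral_std_gaussian_exp_norm_sq[OF t, symmetric], subst nn_integral_std_gaussian_set_component[OF v])
       (auto simp: ip_set_component_self[OF v])
  also have "\<dots> = (\<integral>\<^sup>+s. ennreal (exp (- t * s\<^sup>2)) * ?E \<partial>std_normal)"
    by (intro nn_integral_cong, subst nn_integral_cmult[symmetric], measurable)
       (auto intro!: nn_integral_cong simp: ennreal_mult[symmetric] mult_exp_exp algebra_simps)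
  also have "\<dots> = ennreal (shrink t) * ?E"
    by (subst nn_integral_multc) (auto simp: nn_integral_std_normal_exp_sq[OF t, simplified])
  finally have eq: "ennreal (shrink t) * ?E = ennreal (shrink t) * ennreal (shrink t ^ (n - 1))"
    using n k by (cases n) (auto simp: ennreal_mult[symmetric])
  then show ?thesis
    using k by (simp add: ennreal_mult_cancel_left)
qed

text \<open>The Gamma integral after rescaling t by S. At S = 0 both sides are infinite, so the
  formula may be applied at every point x without excluding a null set.\<close>

lemma nn_integral_power_exp:
  assumes S: "S \<ge> 0"
  shows "(\<integral>\<^sup>+t. ennreal (t ^ q * exp (- t * S)) * indicator {0..} t \<partial>lborel) = ennreal (fact q) * inverse (ennreal S) ^ Suc q"
proof (cases "S = 0")
  case True
  have "(\<integral>\<^sup>+t. ennreal (t ^ q * exp (- t * S)) * indicator {0..} t \<partial>lborel) \<ge> (\<integral>\<^sup>+t. indicator {1::real..} t \<partial>lborel)"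
    using True by (intro nn_integral_mono) (auto split: split_indicator)
  moreover have "emeasure lborel {1::real..} = \<infinity>"
  proof (rule ccontr)
    assume "emeasure lborel {1::real..} \<noteq> \<infinity>"
    then obtain r where r: "emeasure lborel {1::real..} = ennreal r" "r \<ge> 0"
      by (cases "emeasure lborel {1::real..}") auto
    have "emeasure lborel {1..r + 2} \<le> emeasure lborel {1::real..}"
      by (rule emeasure_mono) auto
    with r show False by simp
  qed
  ultimately show ?thesis
    using True by (simp add: ennreal_mult_top top_unique)
next
  case False
  then have S: "S > 0" using S by simp
  have "ennreal (fact q) = (\<integral>\<^sup>+t. ennreal (t ^ q * exp (- t)) * indicator {0..} t \<partial>lborel)"
    by (simp add: nn_intergal_power_times_exp_Ici)
  also have "\<dots> = ennreal S * (\<integral>\<^sup>+t. ennreal (S ^ q) * (ennreal (t ^ q * exp (- t * S)) * indicator {0..} t) \<partial>lborel)"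
  proof (subst nn_integral_real_affine[where c=S and t=0])
    have "ennreal ((S * t) ^ q * exp (- (S * t))) * indicator {0..} (S * t) =
        ennreal (S ^ q) * (ennreal (t ^ q * exp (- t * S)) * indicator {0..} t)" for t
      using S by (cases "t \<ge> 0")
        (auto simp: ennreal_mult[symmetric] power_mult_distrib zero_le_mult_iff mult_ac)
    then show "ennreal \<bar>S\<bar> * (\<integral>\<^sup>+t. ennreal ((0 + S * t) ^ q * exp (- (0 + S * t))) * indicator {0..} (0 + S * t) \<partial>lborel) =
        ennreal S * (\<integral>\<^sup>+t. ennreal (S ^ q) * (ennreal (t ^ q * exp (- t * S)) * indicator {0..} t) \<partial>lborel)"
      using S by simp
  qed (use S in auto)
  also have "\<dots> = ennreal S ^ Suc q * (\<integral>\<^sup>+t. ennreal (t ^ q * exp (- t * S)) * indicator {0..} t \<partial>lborel)"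
    using S by (subst nn_integral_cmult) (auto simp: ennreal_power mult.assoc)
  finally have "ennreal (fact q) * inverse (ennreal S) ^ Suc q =
      (ennreal S ^ Suc q * inverse (ennreal S) ^ Suc q) * (\<integral>\<^sup>+t. ennreal (t ^ q * exp (- t * S)) * indicator {0..} t \<partial>lborel)"
    by (simp add: mult_ac)
  also have "ennreal S ^ Suc q * inverse (ennreal S) ^ Suc q = 1"
    using S by (subst power_mult_distrib[symmetric]) (simp add: ennreal_divide_self flip: divide_ennreal_def)
  finally show ?thesis by simp
qed

text \<open>Negative moments of a nonnegative variable are Mellin transforms of its Laplace transform.\<close>

lemma nn_integral_inverse_power:
  assumes [measurable]: "f \<in> borel_measurable (std_gaussian n)" and f: "\<And>x. f x \<ge> 0"
    and L: "\<And>t. t \<ge> 0 \<Longrightarrow> (\<integral>\<^sup>+x. ennreal (exp (- t * f x)) \<partial>std_gaussian n) = ennreal (L t)"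
    and [measurable]: "L \<in> borel_measurable borel"
  shows "ennreal (fact q) * (\<integral>\<^sup>+x. inverse (ennreal (f x)) ^ Suc q \<partial>std_gaussian n) =
    (\<integral>\<^sup>+t. ennreal (t ^ q * L t) * indicator {0..} t \<partial>lborel)"
proof -
  interpret P: pair_sigma_finite "std_gaussian n" lborel by standard
  have "ennreal (fact q) * (\<integral>\<^sup>+x. inverse (ennreal (f x)) ^ Suc q \<partial>std_gaussian n) =
      (\<integral>\<^sup>+x. \<integral>\<^sup>+t. ennreal (t ^ q * exp (- t * f x)) * indicator {0..} t \<partial>lborel \<partial>std_gaussian n)"
    by (subst nn_integral_cmult[symmetric]) (simp_all only: nn_integral_power_exp[OF f], measurable)
  also have "\<dots> = (\<integral>\<^sup>+t. \<integral>\<^sup>+x. ennreal (t ^ q * exp (- t * f x)) * indicator {0..} t \<partial>std_gaussian n \<partial>lborel)"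
    by (rule P.Fubini'[symmetric]) measurable
  also have "\<dots> = (\<integral>\<^sup>+t. ennreal (t ^ q * L t) * indicator {0..} t \<partial>lborel)"
  proof (rule nn_integral_cong)
    fix t :: real
    show "(\<integral>\<^sup>+x. ennreal (t ^ q * exp (- t * f x)) * indicator {0..} t \<partial>std_gaussian n) =
      ennreal (t ^ q * L t) * indicator {0..} t"
    proof (cases "t \<ge> 0")
      case True
      have "(\<integral>\<^sup>+x. ennreal (t ^ q * exp (- t * f x)) * indicator {0..} t \<partial>std_gaussian n) =
          (\<integral>\<^sup>+x. ennreal (t ^ q) * ennreal (exp (- t * f x)) \<partial>std_gaussian n)"
        using True by (auto simp: ennreal_mult intro!: nn_integral_cong)
      also have "\<dots> = ennreal (t ^ q) * ennreal (L t)"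
        by (subst nn_integral_cmult) (auto simp: L[OF True, simplified])
      finally show ?thesis using True by (simp add: ennreal_mult')
    qed simp
  qed
  finally show ?thesis .
qed

text \<open>Equals \<open>fact q\<close> times the Gaussian expectation of |x|^(-2(q+1)) in
  dimension n; the index q is one less than the power of 1 / |x|^2.\<close>

definition shrink_moment :: "nat \<Rightarrow> nat \<Rightarrow> ennreal" where
  "shrink_moment q n = (\<integral>\<^sup>+t. ennreal (t ^ q * shrink t ^ n) * indicator {0..} t \<partial>lborel)"

text \<open>Of the available powers of \<open>shrink t\<close>, 2 q absorb t^q because t * (shrink
  t)^2 is at most 1, and four more leave the integrable (1 + 2 t)^(-2).\<close>

lemma shrink_moment_finite:
  assumes "2 * q + 4 \<le> n"
  shows "shrink_moment q n < \<infinity>"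
proof -
  have "shrink_moment q n \<le> (\<integral>\<^sup>+t. ennreal (1 / (1 + 2 * t)\<^sup>2) * indicator {0..} t \<partial>lborel)"
    unfolding shrink_moment_def
  proof (intro nn_integral_mono)
    fix t :: real
    have "t ^ q * shrink t ^ n \<le> 1 / (1 + 2 * t)\<^sup>2" if t: "t \<ge> 0"
    proof -
      have "t ^ q * shrink t ^ n \<le> t ^ q * shrink t ^ (2 * q + 4)"
        using t assms shrink_pos[OF t] shrink_le_1[OF t] by (intro mult_left_mono power_decreasing) auto
      also have "\<dots> = (t * (shrink t)\<^sup>2) ^ q * (shrink t) ^ 4"
        by (simp add: power_add power_mult power_mult_distrib)
      also have "\<dots> \<le> 1 ^ q * (shrink t) ^ 4"
      proof (intro mult_right_mono power_mono)
        have "t * (shrink t)\<^sup>2 \<le> (1 + 2 * t) * (shrink t)\<^sup>2" using t by (intro mult_right_mono) auto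
        then show "t * (shrink t)\<^sup>2 \<le> 1" using shrink_sq[OF t] by (simp add: mult.commute)
      qed (use t in auto)
      also have "shrink t ^ 4 = ((shrink t)\<^sup>2)\<^sup>2" by simp
      also have "(shrink t)\<^sup>2 = 1 / (1 + 2 * t)" using t shrink_sq[OF t] by (simp add: field_simps)
      finally show ?thesis by (simp add: power_divide)
    qed
    then show "ennreal (t ^ q * shrink t ^ n) * indicator {0..} t \<le> ennreal (1 / (1 + 2 * t)\<^sup>2) * indicator {0..} t"
      by (auto split: split_indicator intro!: ennreal_leI)
  qed
  also have "\<dots> = ennreal (0 - (- 1 / 2) * inverse (1 + 2 * 0))"
  proof (rule nn_integral_FTC_atLeast)
    fix t :: real assume "0 \<le> t"
    then show "((\<lambda>t. (- 1 / 2) * inverse (1 + 2 * t)) has_real_derivative 1 / (1 + 2 * t)\<^sup>2) (at t)"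
      by (auto intro!: derivative_eq_intros simp: power2_eq_square inverse_eq_divide)
         (subst frac_eq_eq, simp, simp, simp add: algebra_simps)
  next
    show "((\<lambda>t::real. (- 1 / 2) * inverse (1 + 2 * t)) \<longlongrightarrow> 0) at_top"
      by (intro tendsto_mult_right_zero tendsto_inverse_0_at_top filterlim_tendsto_add_at_top[OF tendsto_const]
        filterlim_tendsto_pos_mult_at_top[OF tendsto_const] filterlim_ident) auto
  qed auto
  also have "\<dots> < \<infinity>" by (simp only: ennreal_less_top infinity_ennreal_def)
  finally show ?thesis .
qed

text \<open>Monotone convergence along [0, k]. It allows integration by parts on compact intervals,
  where continuity gives integrability and only the sign of the boundary term matters.\<close>

lemma nn_integral_atLeast_le:
  fixes f g :: "real \<Rightarrow> ennreal"
  assumes [measurable]: "f \<in> borel_measurable borel" "g \<in> borel_measurable borel"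
    and le: "\<And>T. T \<ge> 0 \<Longrightarrow> (\<integral>\<^sup>+t. f t * indicator {0..T} t \<partial>lborel) \<le> (\<integral>\<^sup>+t. g t * indicator {0..T} t \<partial>lborel)"
  shows "(\<integral>\<^sup>+t. f t * indicator {0..} t \<partial>lborel) \<le> (\<integral>\<^sup>+t. g t * indicator {0..} t \<partial>lborel)"
proof -
  have "f t * indicator {0..} t = (SUP k::nat. f t * indicator {0..real k} t)" for t
  proof (rule antisym)
    obtain k :: nat where "t \<le> real k" using real_arch_simple by blast
    then show "f t * indicator {0..} t \<le> (SUP k::nat. f t * indicator {0..real k} t)"
      by (intro SUP_upper2[where i=k]) (auto split: split_indicator)
    show "(SUP k::nat. f t * indicator {0..real k} t) \<le> f t * indicator {0..} t"
      by (intro SUP_least) (auto split: split_indicator)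
  qed
  then have "(\<integral>\<^sup>+t. f t * indicator {0..} t \<partial>lborel) = (\<integral>\<^sup>+t. (SUP k::nat. f t * indicator {0..real k} t) \<partial>lborel)"
    by simp
  also have "\<dots> = (SUP k::nat. \<integral>\<^sup>+t. f t * indicator {0..real k} t \<partial>lborel)"
    by (rule nn_integral_monotone_convergence_SUP) (auto simp: incseq_def le_fun_def split: split_indicator)
  also have "\<dots> \<le> (\<integral>\<^sup>+t. g t * indicator {0..} t \<partial>lborel)"
  proof (rule SUP_least)
    fix k :: nat
    have "(\<integral>\<^sup>+t. f t * indicator {0..real k} t \<partial>lborel) \<le> (\<integral>\<^sup>+t. g t * indicator {0..real k} t \<partial>lborel)"
      by (rule le) simp
    also have "\<dots> \<le> (\<integral>\<^sup>+t. g t * indicator {0..} t \<partial>lborel)"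
      by (intro nn_integral_mono) (auto split: split_indicator)
    finally show "(\<integral>\<^sup>+t. f t * indicator {0..real k} t \<partial>lborel) \<le> (\<integral>\<^sup>+t. g t * indicator {0..} t \<partial>lborel)" .
  qed
  finally show ?thesis .
qed

text \<open>Integrating the derivative of t^(q+1) (shrink t)^(n-2) over [0, T] gives (n - 2 q - 4)
  I(q+1) \<le> (q + 1) I(q) for the truncated moments I. The hypothesis on n is exactly n - 2 q - 4
  \<ge> q + 1.\<close>

lemma shrink_moment_Suc_le:
  assumes n: "3 * q + 5 \<le> n"
  shows "shrink_moment (Suc q) n \<le> shrink_moment q n"
  unfolding shrink_moment_def
proof (rule nn_integral_atLeast_le)
  fix T :: real assume T: "T \<ge> 0"
  \<comment> \<open>The exponent n - 2 is chosen because the derivative of \<open>shrink\<close> is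
    - shrink^3 and shrink^(-2) is 1 + 2 t: both terms of the derivative become (shrink t)^n times a
    polynomial.\<close>
  define F where "F t = t ^ Suc q * shrink t ^ (n - 2)" for t
  define F' where "F' t = t ^ q * shrink t ^ n * (real (q + 1) - (real n - 2 - 2 * real (q + 1)) * t)" for t
  have D: "(shrink has_real_derivative (- (shrink t ^ 3))) (at t)" if "t \<ge> 0" for t
    using that unfolding shrink_def[abs_def]
    by (auto intro!: derivative_eq_intros simp: power_divide eval_nat_numeral field_simps)
  have cont: "isCont shrink t" if "t \<ge> 0" for t
    using DERIV_isCont[OF D[OF that]] .
  have n2: "n = Suc (Suc (n - 2))" using n by simp
  have DF: "(F has_real_derivative F' t) (at t)" if t: "t \<ge> 0" for t
  proof -
    have "(F has_real_derivative (real (q + 1) * t ^ q * shrink t ^ (n - 2) +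
        t ^ Suc q * (real (n - 2) * (- (shrink t ^ 3)) * shrink t ^ (n - 2 - 1)))) (at t)"
      unfolding F_def
      by (rule DERIV_cong[OF DERIV_mult[OF DERIV_pow[of "Suc q" t] DERIV_power[OF D[OF t], of "n - 2"]]]) simp
    also have "real (q + 1) * t ^ q * shrink t ^ (n - 2) +
        t ^ Suc q * (real (n - 2) * (- (shrink t ^ 3)) * shrink t ^ (n - 2 - 1)) = F' t"
    proof -
      have "shrink t ^ (n - 2) = shrink t ^ (n - 2) * ((shrink t)\<^sup>2 * (1 + 2 * t))"
        using shrink_sq[OF t] by simp
      also have "\<dots> = shrink t ^ n * (1 + 2 * t)"
        by (subst (2) n2) (simp add: power2_eq_square)
      finally have 1: "shrink t ^ (n - 2) = shrink t ^ n * (1 + 2 * t)" .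
      have "n = 3 + (n - 2 - 1)" using n by simp
      then have 2: "shrink t ^ 3 * shrink t ^ (n - 2 - 1) = shrink t ^ n"
        by (metis power_add)
      have 3: "real (n - 2) = real n - 2" using n by simp
      have "real (q + 1) * t ^ q * shrink t ^ (n - 2) + t ^ Suc q * (real (n - 2) * (- (shrink t ^ 3)) * shrink t ^ (n - 2 - 1)) =
          real (q + 1) * t ^ q * shrink t ^ (n - 2) - t ^ Suc q * (real (n - 2) * (shrink t ^ 3 * shrink t ^ (n - 2 - 1)))"
        by simp
      also have "\<dots> = F' t"
        unfolding 2 unfolding 1 3 F'_def by (simp add: algebra_simps)
      finally show ?thesis .
    qed
    finally show ?thesis .
  qed
  have int: "integrable lborel (\<lambda>t. (t ^ k * shrink t ^ n) * indicator {0..T} t)" for k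
    by (rule borel_integrable_atLeastAtMost) (auto intro!: continuous_intros cont)
  have "0 \<le> F T - F 0"
    using T shrink_pos[OF T] by (simp add: F_def)
  also have "F T - F 0 = (\<integral>t. F' t * indicator {0..T} t \<partial>lborel)"
    using T by (intro integral_FTC_Icc_real[symmetric] DF) (auto simp: F'_def intro!: continuous_intros cont)
  also have "\<dots> \<le> (\<integral>t. real (q + 1) * ((t ^ q * shrink t ^ n) * indicator {0..T} t - (t ^ Suc q * shrink t ^ n) * indicator {0..T} t) \<partial>lborel)"
  proof (rule integral_mono)
    show "integrable lborel (\<lambda>t. F' t * indicator {0..T} t)"
      by (rule borel_integrable_atLeastAtMost) (auto simp: F'_def intro!: continuous_intros cont)
    show "integrable lborel (\<lambda>t. real (q + 1) * ((t ^ q * shrink t ^ n) * indicator {0..T} t - (t ^ Suc q * shrink t ^ n) * indicator {0..T} t))"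
      by (intro integrable_mult_right Bochner_Integration.integrable_diff int)
    fix t :: real
    show "F' t * indicator {0..T} t \<le> real (q + 1) * ((t ^ q * shrink t ^ n) * indicator {0..T} t - (t ^ Suc q * shrink t ^ n) * indicator {0..T} t)"
    proof (cases "t \<in> {0..T}")
      case True
      then have t: "t \<ge> 0" by simp
      have "real (3 * q + 5) \<le> real n" using n by (simp only: of_nat_le_iff)
      then have "real (q + 1) \<le> real n - 2 - 2 * real (q + 1)" by simp
      then have "real (q + 1) * t \<le> (real n - 2 - 2 * real (q + 1)) * t"
        using t by (rule mult_right_mono)
      then have "F' t \<le> t ^ q * shrink t ^ n * (real (q + 1) - real (q + 1) * t)"
        unfolding F'_def using t shrink_pos[OF t] by (intro mult_left_mono) auto
      then show ?thesis using True by (simp add: algebra_simps)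
    qed simp
  qed
  also have "\<dots> = real (q + 1) * ((\<integral>t. (t ^ q * shrink t ^ n) * indicator {0..T} t \<partial>lborel) - (\<integral>t. (t ^ Suc q * shrink t ^ n) * indicator {0..T} t \<partial>lborel))"
    by (subst integral_mult_right_zero, subst Bochner_Integration.integral_diff) (rule int refl)+
  finally have le: "(\<integral>t. (t ^ Suc q * shrink t ^ n) * indicator {0..T} t \<partial>lborel) \<le> (\<integral>t. (t ^ q * shrink t ^ n) * indicator {0..T} t \<partial>lborel)"
    by (simp add: zero_le_mult_iff)
  have eq: "(\<integral>\<^sup>+t. ennreal (t ^ k * shrink t ^ n) * indicator {0..T} t \<partial>lborel) = ennreal (\<integral>t. (t ^ k * shrink t ^ n) * indicator {0..T} t \<partial>lborel)" for k
  proof -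
    have "(\<integral>\<^sup>+t. ennreal (t ^ k * shrink t ^ n) * indicator {0..T} t \<partial>lborel) = (\<integral>\<^sup>+t. ennreal ((t ^ k * shrink t ^ n) * indicator {0..T} t) \<partial>lborel)"
      by (intro nn_integral_cong) (auto split: split_indicator)
    also have "\<dots> = ennreal (\<integral>t. (t ^ k * shrink t ^ n) * indicator {0..T} t \<partial>lborel)"
      by (rule nn_integral_eq_integral[OF int]) (auto split: split_indicator intro!: AE_I2 mult_nonneg_nonneg zero_le_power less_imp_le[OF shrink_pos])
    finally show ?thesis .
  qed
  show "(\<integral>\<^sup>+t. ennreal (t ^ Suc q * shrink t ^ n) * indicator {0..T} t \<partial>lborel) \<le> (\<integral>\<^sup>+t. ennreal (t ^ q * shrink t ^ n) * indicator {0..T} t \<partial>lborel)"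
    unfolding eq using le by (rule ennreal_leI)
qed measurable

text \<open>The factor 1 + t paid for the missing power splits the moment in dimension n - 1 into
  those of order q and q + 1 in dimension n, and the latter is no larger than the former. This is
  the origin of the second moment bound 2.\<close>

lemma shrink_moment_pred_le:
  assumes n: "3 * q + 5 \<le> n"
  shows "shrink_moment q (n - 1) \<le> 2 * shrink_moment q n"
proof -
  have "shrink_moment q (n - 1) \<le> (\<integral>\<^sup>+t. ennreal (t ^ q * shrink t ^ n) * indicator {0..} t +
      ennreal (t ^ Suc q * shrink t ^ n) * indicator {0..} t \<partial>lborel)"
    unfolding shrink_moment_def
  proof (rule nn_integral_mono)
    fix t :: real
    show "ennreal (t ^ q * shrink t ^ (n - 1)) * indicator {0..} t \<le>
      ennreal (t ^ q * shrink t ^ n) * indicator {0..} t + ennreal (t ^ Suc q * shrink t ^ n) * indicator {0..} t"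
    proof (cases "t \<ge> 0")
      case t: True
      have "t ^ q * shrink t ^ (n - 1) * 1 \<le> t ^ q * shrink t ^ (n - 1) * (shrink t * (1 + t))"
        using t shrink_pos[OF t] by (intro mult_left_mono shrink_mult_le) auto
      also have "\<dots> = t ^ q * shrink t ^ n + t ^ Suc q * shrink t ^ n"
        using n by (simp add: power_eq_if[of _ n] algebra_simps)
      finally show ?thesis
        using t shrink_pos[OF t] by (simp flip: ennreal_plus)
    qed simp
  qed
  also have "\<dots> = shrink_moment q n + shrink_moment (Suc q) n"
    unfolding shrink_moment_def by (rule nn_integral_add) auto
  also have "\<dots> \<le> 2 * shrink_moment q n"
    using add_left_mono[OF shrink_moment_Suc_le[OF n], of "shrink_moment q n"] by (simp add: mult_2)
  finally show ?thesis .
qed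

subsection \<open>The prior on hyperplanes\<close>

definition inv_moment :: "nat \<Rightarrow> nat \<Rightarrow> ennreal" where
  "inv_moment m n = (\<integral>\<^sup>+x. inverse (ennreal (ip n x x)) ^ m \<partial>std_gaussian n)"

lemma ennreal_cmult_le_cancel:
  fixes c :: ennreal
  assumes "c * a \<le> c * b" "c \<noteq> 0" "c \<noteq> \<top>"
  shows "a \<le> b"
  using ennreal_mult_le_mult_iff[OF assms(2,3), of a b] assms(1) by simp

text \<open>With q = m - 1 both expectations turn into shrink moments, in dimensions n and n - 1,
  and the common factor \<open>fact q\<close> cancels. The comparison needs 3 q + 5 = 3 m + 2 \<le>
  n, which follows from 5 m \<le> n for positive m, and finiteness needs only 2 m + 2 \<le>
  n.\<close>

lemma inv_moment_bounds:
  assumes n: "5 * m \<le> n" and m: "m > 0"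
  shows "inv_moment m n \<noteq> 0" "inv_moment m n \<noteq> \<top>"
    and "ip n w w = 1 \<Longrightarrow> (\<integral>\<^sup>+x. inverse (ennreal (ip n x x - (ip n x w)\<^sup>2)) ^ m \<partial>std_gaussian n) \<le> 2 * inv_moment m n"
proof -
  obtain q where q: "m = Suc q" using m by (cases m) auto
  have eq: "ennreal (fact q) * inv_moment m n = shrink_moment q n"
    unfolding inv_moment_def shrink_moment_def q
    by (rule nn_integral_inverse_power) (auto simp: ip_nonneg nn_integral_std_gaussian_exp_norm_sq[simplified])
  have "shrink_moment q n < \<infinity>"
    using n q by (intro shrink_moment_finite) auto
  then show "inv_moment m n \<noteq> \<top>"
    using eq by (auto simp: ennreal_mult_top)
  show "inv_moment m n \<noteq> 0"
  proof
    assume "inv_moment m n = 0"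
    then have "AE x in std_gaussian n. inverse (ennreal (ip n x x)) ^ m = 0"
      unfolding inv_moment_def by (subst (asm) nn_integral_0_iff_AE) auto
    then show False
      using std_gaussian.AE_False[of n] by (auto simp: q)
  qed
  assume w: "ip n w w = 1"
  have nonneg: "ip n x x - (ip n x w)\<^sup>2 \<ge> 0" for x
    using ip_set_component_self[OF w, of 0 x] ip_nonneg[of n "set_component n w 0 x"] by simp
  have "ennreal (fact q) * (\<integral>\<^sup>+x. inverse (ennreal (ip n x x - (ip n x w)\<^sup>2)) ^ m \<partial>std_gaussian n) = shrink_moment q (n - 1)"
    unfolding shrink_moment_def q
    by (rule nn_integral_inverse_power) (auto simp: nonneg[simplified] nn_integral_std_gaussian_exp_proj_norm_sq[OF _ w, simplified])
  also have "\<dots> \<le> 2 * shrink_moment q n"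
    using n q by (intro shrink_moment_pred_le) auto
  also have "\<dots> = ennreal (fact q) * (2 * inv_moment m n)"
    by (simp add: eq[symmetric] mult_ac)
  finally show "(\<integral>\<^sup>+x. inverse (ennreal (ip n x x - (ip n x w)\<^sup>2)) ^ m \<partial>std_gaussian n) \<le> 2 * inv_moment m n"
    by (rule ennreal_cmult_le_cancel) auto
qed

text \<open>A vector of norm zero is sent to the first basis vector, so that for n > 0 the result is
  a unit vector without exception.\<close>

definition normalize_Rn :: "nat \<Rightarrow> (nat \<Rightarrow> real) \<Rightarrow> nat \<Rightarrow> real" where
  "normalize_Rn n x = (\<lambda>i\<in>{..<n}. if ip n x x = 0 then of_bool (i = 0) else x i / sqrt (ip n x x))"

lemma measurable_normalize_Rn [measurable]: "normalize_Rn n \<in> borel_Rn n \<rightarrow>\<^sub>M borel_Rn n"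
  unfolding normalize_Rn_def[abs_def]
proof (rule measurable_RnI)
  fix i assume "i < n"
  then have [measurable]: "(\<lambda>x. x i) \<in> borel_measurable (borel_Rn n)"
    by (intro measurable_Rn_component[of "\<lambda>x. x"]) auto
  show "(\<lambda>x. if ip n x x = 0 then of_bool (i = 0) else x i / sqrt (ip n x x)) \<in> borel_measurable (borel_Rn n)"
    by measurable
qed

lemma ip_normalize_Rn:
  assumes "ip n x x \<noteq> 0"
  shows "ip n (normalize_Rn n x) w = ip n x w / sqrt (ip n x x)"
  using assms by (simp add: ip_def normalize_Rn_def sum_divide_distrib)

lemma normalize_Rn_unit:
  assumes "n > 0"
  shows "ip n (normalize_Rn n x) (normalize_Rn n x) = 1"
proof (cases "ip n x x = 0")
  case True
  then have "ip n (normalize_Rn n x) (normalize_Rn n x) = (\<Sum>i<n. of_bool (i = 0))"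
    unfolding ip_def[of n "normalize_Rn n x"] by (intro sum.cong) (auto simp: normalize_Rn_def)
  also have "\<dots> = 1" using assms by (simp add: of_bool_def)
  finally show ?thesis .
next
  case False
  then have "ip n x (normalize_Rn n x) = ip n x x / sqrt (ip n x x)"
    by (subst ip_commute) (simp add: ip_normalize_Rn)
  then show ?thesis
    using False ip_nonneg[of n x] by (simp add: ip_normalize_Rn)
qed

text \<open>
  The random normal vector is uniform on the sphere.  It is realised as the direction of \<open>x\<close> under the
  Gaussian reweighted by \<open>|x| ^ (- 2 * m)\<close>, because this cancels the normalisation in \<open>1 - \<langle>v, w\<rangle>\<^sup>2\<close>.
\<close>

lemma exists_prior:
  assumes n: "5 * m \<le> n" and m: "m > 0"
  obtains \<mu> where "prob_space \<mu>" "sets \<mu> = sets (borel_Rn n)" "AE v in \<mu>. ip n v v = 1"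
    "\<forall>w. ip n w w = 1 \<longrightarrow> (\<integral>\<^sup>+v. inverse (ennreal (1 - (ip n v w)\<^sup>2)) ^ m \<partial>\<mu>) \<le> 2"
proof
  define Z where "Z = inv_moment m n"
  have Z: "Z \<noteq> 0" "Z \<noteq> \<top>"
    using inv_moment_bounds[OF n m] by (auto simp: Z_def)
  define d where "d x = inverse (ennreal (ip n x x)) ^ m / Z" for x
  have [measurable]: "d \<in> borel_measurable (borel_Rn n)"
    unfolding d_def by measurable
  define \<mu>\<^sub>0 where "\<mu>\<^sub>0 = density (std_gaussian n) d"
  define \<mu> where "\<mu> = distr \<mu>\<^sub>0 (borel_Rn n) (normalize_Rn n)"
  have [measurable_cong]: "sets \<mu>\<^sub>0 = sets (borel_Rn n)" by (simp add: \<mu>\<^sub>0_def)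
  show "sets \<mu> = sets (borel_Rn n)" by (simp add: \<mu>_def)
  have "emeasure \<mu>\<^sub>0 (space \<mu>\<^sub>0) = (\<integral>\<^sup>+x. inverse (ennreal (ip n x x)) ^ m \<partial>std_gaussian n) / Z"
  proof -
    have "emeasure \<mu>\<^sub>0 (space \<mu>\<^sub>0) = (\<integral>\<^sup>+x. d x * indicator (space \<mu>\<^sub>0) x \<partial>std_gaussian n)"
      unfolding \<mu>\<^sub>0_def by (rule emeasure_density) (use sets.top[of "borel_Rn n"] in auto)
    also have "\<dots> = (\<integral>\<^sup>+x. d x \<partial>std_gaussian n)"
      by (intro nn_integral_cong) (simp add: \<mu>\<^sub>0_def)
    also have "\<dots> = (\<integral>\<^sup>+x. inverse (ennreal (ip n x x)) ^ m \<partial>std_gaussian n) / Z"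
      unfolding d_def by (rule nn_integral_divide) auto
    finally show ?thesis .
  qed
  also have "\<dots> = 1"
    using Z by (simp add: Z_def inv_moment_def[symmetric] ennreal_divide_self top.not_eq_extremum)
  finally have "prob_space \<mu>\<^sub>0" by (rule prob_spaceI)
  then show "prob_space \<mu>"
    unfolding \<mu>_def by (rule prob_space.prob_space_distr) measurable
  have "n > 0" using n m by simp
  then show "AE v in \<mu>. ip n v v = 1"
    unfolding \<mu>_def by (subst AE_distr_iff, measurable) (simp add: normalize_Rn_unit)
  \<comment> \<open>Finiteness of the negative moment already excludes norm zero almost everywhere,
    since the inverse of 0 is infinite and m is positive.\<close>
  have "AE x in std_gaussian n. inverse (ennreal (ip n x x)) ^ m \<noteq> \<infinity>"
    using Z(2) by (intro nn_integral_PInf_AE) (auto simp: Z_def inv_moment_def)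
  then have ae: "AE x in std_gaussian n. ip n x x \<noteq> 0"
    by eventually_elim (use m in \<open>auto simp: power_eq_top_ennreal\<close>)
  show "\<forall>w. ip n w w = 1 \<longrightarrow> (\<integral>\<^sup>+v. inverse (ennreal (1 - (ip n v w)\<^sup>2)) ^ m \<partial>\<mu>) \<le> 2"
  proof (intro allI impI)
    fix w assume w: "ip n w w = 1"
    have "(\<integral>\<^sup>+v. inverse (ennreal (1 - (ip n v w)\<^sup>2)) ^ m \<partial>\<mu>) =
        (\<integral>\<^sup>+x. inverse (ennreal (1 - (ip n (normalize_Rn n x) w)\<^sup>2)) ^ m \<partial>\<mu>\<^sub>0)"
      unfolding \<mu>_def by (rule nn_integral_distr) auto
    also have "\<dots> = (\<integral>\<^sup>+x. d x * inverse (ennreal (1 - (ip n (normalize_Rn n x) w)\<^sup>2)) ^ m \<partial>std_gaussian n)"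
      unfolding \<mu>\<^sub>0_def by (rule nn_integral_density) auto
    also have "\<dots> = (\<integral>\<^sup>+x. inverse (ennreal (ip n x x - (ip n x w)\<^sup>2)) ^ m / Z \<partial>std_gaussian n)"
    proof (rule nn_integral_cong_AE, use ae in eventually_elim)
      fix x assume x: "ip n x x \<noteq> 0"
      define a where "a = ip n x x"
      define b where "b = a - (ip n x w)\<^sup>2"
      have a: "a > 0" using x ip_nonneg[of n x] by (simp add: a_def)
      have b: "b \<ge> 0"
        using ip_set_component_self[OF w, of 0 x] ip_nonneg[of n "set_component n w 0 x"] by (simp add: b_def a_def)
      have "1 - (ip n (normalize_Rn n x) w)\<^sup>2 = b / a"
        using a by (simp add: ip_normalize_Rn[OF x] a_def[symmetric] b_def power_divide diff_divide_distrib)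
      \<comment> \<open>b = 0 means that x is parallel to w; then both sides are infinite.\<close>
      moreover have "inverse (ennreal a) * inverse (ennreal (b / a)) = inverse (ennreal b)"
      proof (cases "b = 0")
        case True
        then show ?thesis using a by (simp add: ennreal_mult_top)
      next
        case False
        then show ?thesis using a b
          by (simp add: inverse_ennreal ennreal_mult[symmetric] inverse_eq_divide)
      qed
      moreover have "inverse (ennreal a) ^ m / Z * inverse (ennreal (b / a)) ^ m =
          (inverse (ennreal a) * inverse (ennreal (b / a))) ^ m / Z"
        by (simp add: divide_ennreal_def power_mult_distrib mult_ac)
      ultimately show "d x * inverse (ennreal (1 - (ip n (normalize_Rn n x) w)\<^sup>2)) ^ m =
          inverse (ennreal (ip n x x - (ip n x w)\<^sup>2)) ^ m / Z"
        unfolding d_def a_def[symmetric] b_def[symmetric] by simp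
    qed
    also have "\<dots> = (\<integral>\<^sup>+x. inverse (ennreal (ip n x x - (ip n x w)\<^sup>2)) ^ m \<partial>std_gaussian n) / Z"
      by (rule nn_integral_divide) auto
    also have "\<dots> \<le> 2 * Z / Z"
      using inv_moment_bounds(3)[OF n m w] by (intro divide_right_mono_ennreal) (simp add: Z_def)
    also have "\<dots> = 2"
      using Z by (simp add: ennreal_times_divide[symmetric] ennreal_divide_self top.not_eq_extremum)
    finally show "(\<integral>\<^sup>+v. inverse (ennreal (1 - (ip n v w)\<^sup>2)) ^ m \<partial>\<mu>) \<le> 2" .
  qed
qed

section \<open>Likelihood ratios of smeared samples and the second moment of their mixture\<close>

definition sample_weight :: "nat \<Rightarrow> nat \<Rightarrow> real \<Rightarrow> (nat \<Rightarrow> real) \<Rightarrow> (nat \<Rightarrow> nat \<Rightarrow> real) \<Rightarrow> ennreal" where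
  "sample_weight m n \<epsilon> v G = (\<Prod>i<m. slab_weight \<epsilon> (ip n (G i) v))"

abbreviation sample_space :: "nat \<Rightarrow> nat \<Rightarrow> (nat \<Rightarrow> nat \<Rightarrow> real) measure" where
  "sample_space m n \<equiv> PiM {..<m} (\<lambda>_. borel_Rn n)"

abbreviation gaussian_samples :: "nat \<Rightarrow> nat \<Rightarrow> (nat \<Rightarrow> nat \<Rightarrow> real) measure" where
  "gaussian_samples m n \<equiv> PiM {..<m} (\<lambda>_. std_gaussian n)"

lemma sets_gaussian_samples [measurable_cong, simp]: "sets (gaussian_samples m n) = sets (sample_space m n)"
  by (intro sets_PiM_cong) auto

lemma prob_space_gaussian_samples: "prob_space (gaussian_samples m n)"
  by (intro prob_space_PiM prob_space_std_gaussian)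

lemma measurable_sample_weight [measurable (raw)]:
  assumes "g \<in> M \<rightarrow>\<^sub>M borel_Rn n" "f \<in> M \<rightarrow>\<^sub>M sample_space m n"
  shows "(\<lambda>x. sample_weight m n \<epsilon> (g x) (f x)) \<in> borel_measurable M"
  unfolding sample_weight_def
proof (intro borel_measurable_prod_ennreal)
  fix i assume "i \<in> {..<m}"
  then have [measurable]: "(\<lambda>x. f x i) \<in> M \<rightarrow>\<^sub>M borel_Rn n"
    using measurable_compose[OF assms(2) measurable_component_singleton] by simp
  note assms(1)[measurable]
  show "(\<lambda>x. slab_weight \<epsilon> (ip n (f x i) (g x))) \<in> borel_measurable M"
    by measurable
qed

lemma nn_integral_sample_weight_product_le:
  assumes v: "ip n v v = 1" and w: "ip n w w = 1" and e: "\<epsilon> > 0"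
  shows "(\<integral>\<^sup>+G. sample_weight m n \<epsilon> v G * sample_weight m n \<epsilon> w G \<partial>gaussian_samples m n)
    \<le> ennreal (exp (\<epsilon>\<^sup>2 / 2)) ^ m * inverse (ennreal (1 - (ip n v w)\<^sup>2)) ^ m"
proof -
  interpret N: product_sigma_finite "\<lambda>_. std_gaussian n" by standard
  have "(\<integral>\<^sup>+G. sample_weight m n \<epsilon> v G * sample_weight m n \<epsilon> w G \<partial>gaussian_samples m n) =
      (\<integral>\<^sup>+G. (\<Prod>i<m. slab_weight \<epsilon> (ip n (G i) v) * slab_weight \<epsilon> (ip n (G i) w)) \<partial>gaussian_samples m n)"
    by (simp add: sample_weight_def prod.distrib)
  also have "\<dots> = (\<Prod>i<m. \<integral>\<^sup>+x. slab_weight \<epsilon> (ip n x v) * slab_weight \<epsilon> (ip n x w) \<partial>std_gaussian n)"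
    by (rule N.product_nn_integral_prod) auto
  also have "\<dots> = (\<integral>\<^sup>+x. slab_weight \<epsilon> (ip n x v) * slab_weight \<epsilon> (ip n x w) \<partial>std_gaussian n) ^ m"
    by simp
  also have "\<dots> \<le> (ennreal (exp (\<epsilon>\<^sup>2 / 2)) * inverse (ennreal (1 - (ip n v w)\<^sup>2))) ^ m"
    using nn_integral_slab_weight_product_le[OF v w e] by (rule power_mono) simp
  finally show ?thesis by (simp add: power_mult_distrib)
qed

text \<open>Cauchy-Schwarz separates the event from the mixture likelihood. The square of the latter
  is a double integral over independent v and w; integrating the samples first leaves the pairwise
  inner products, which \<open>bound\<close> controls for each fixed w. The squared form avoids
  square roots of extended reals.\<close>

lemma mixture_sq_le:
  assumes "prob_space \<mu>" and sets_\<mu>[measurable_cong]: "sets \<mu> = sets (borel_Rn n)"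
    and unit: "AE v in \<mu>. ip n v v = 1"
    and bound: "\<And>w. ip n w w = 1 \<Longrightarrow> (\<integral>\<^sup>+v. inverse (ennreal (1 - (ip n v w)\<^sup>2)) ^ m \<partial>\<mu>) \<le> 2"
    and e: "\<epsilon> > 0" and U[measurable]: "U \<in> sets (sample_space m n)"
  shows "(\<integral>\<^sup>+v. emeasure (density (gaussian_samples m n) (sample_weight m n \<epsilon> v)) U \<partial>\<mu>)\<^sup>2
    \<le> emeasure (gaussian_samples m n) U * (2 * ennreal (exp (\<epsilon>\<^sup>2 / 2)) ^ m)"
proof -
  let ?N = "gaussian_samples m n"
  interpret \<mu>: prob_space \<mu> by fact
  interpret N: prob_space ?N by (rule prob_space_gaussian_samples)
  interpret P: pair_sigma_finite \<mu> ?N by standard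
  define \<L> where "\<L> G = (\<integral>\<^sup>+v. sample_weight m n \<epsilon> v G \<partial>\<mu>)" for G
  have [measurable]: "\<L> \<in> borel_measurable (sample_space m n)"
    unfolding \<L>_def[abs_def] by measurable
  have "(\<integral>\<^sup>+v. emeasure (density ?N (sample_weight m n \<epsilon> v)) U \<partial>\<mu>) =
      (\<integral>\<^sup>+v. \<integral>\<^sup>+G. sample_weight m n \<epsilon> v G * indicator U G \<partial>?N \<partial>\<mu>)"
    by (intro nn_integral_cong emeasure_density) (auto simp: sets_eq_imp_space_eq[OF sets_\<mu>])
  also have "\<dots> = (\<integral>\<^sup>+G. \<integral>\<^sup>+v. sample_weight m n \<epsilon> v G * indicator U G \<partial>\<mu> \<partial>?N)"
    by (rule P.Fubini'[symmetric]) measurable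
  also have "\<dots> = (\<integral>\<^sup>+G. indicator U G * \<L> G \<partial>?N)"
    unfolding \<L>_def
    by (intro nn_integral_cong, subst mult.commute[of "indicator U _"], rule nn_integral_multc)
       (auto simp: sets_eq_imp_space_eq[OF sets_gaussian_samples])
  finally have "(\<integral>\<^sup>+v. emeasure (density ?N (sample_weight m n \<epsilon> v)) U \<partial>\<mu>)\<^sup>2
      \<le> (\<integral>\<^sup>+G. (indicator U G)\<^sup>2 \<partial>?N) * (\<integral>\<^sup>+G. (\<L> G)\<^sup>2 \<partial>?N)"
    by (simp add: Cauchy_Schwarz_nn_integral)
  also have "(\<integral>\<^sup>+G. (indicator U G)\<^sup>2 \<partial>?N) = (\<integral>\<^sup>+G. indicator U G \<partial>?N)"
    by (intro nn_integral_cong) (simp split: split_indicator)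
  also have "\<dots> = emeasure ?N U" by simp
  also have "(\<integral>\<^sup>+G. (\<L> G)\<^sup>2 \<partial>?N) = (\<integral>\<^sup>+G. \<integral>\<^sup>+w. \<integral>\<^sup>+v. sample_weight m n \<epsilon> v G * sample_weight m n \<epsilon> w G \<partial>\<mu> \<partial>\<mu> \<partial>?N)"
  proof (rule nn_integral_cong)
    fix G assume "G \<in> space ?N"
    then have [measurable]: "G \<in> space (sample_space m n)" by (simp add: sets_eq_imp_space_eq[OF sets_gaussian_samples])
    show "(\<L> G)\<^sup>2 = (\<integral>\<^sup>+w. \<integral>\<^sup>+v. sample_weight m n \<epsilon> v G * sample_weight m n \<epsilon> w G \<partial>\<mu> \<partial>\<mu>)"
      unfolding \<L>_def power2_eq_square
      by (subst nn_integral_cmult[symmetric]) (auto intro!: nn_integral_cong nn_integral_multc[symmetric])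
  qed
  also have "\<dots> = (\<integral>\<^sup>+w. \<integral>\<^sup>+G. \<integral>\<^sup>+v. sample_weight m n \<epsilon> v G * sample_weight m n \<epsilon> w G \<partial>\<mu> \<partial>?N \<partial>\<mu>)"
    by (rule P.Fubini') measurable
  also have "\<dots> = (\<integral>\<^sup>+w. \<integral>\<^sup>+v. \<integral>\<^sup>+G. sample_weight m n \<epsilon> v G * sample_weight m n \<epsilon> w G \<partial>?N \<partial>\<mu> \<partial>\<mu>)"
  proof (rule nn_integral_cong, rule P.Fubini')
    fix w assume "w \<in> space \<mu>"
    then have [measurable]: "w \<in> space (borel_Rn n)"
      by (simp add: sets_eq_imp_space_eq[OF sets_\<mu>])
    show "(\<lambda>(v, G). sample_weight m n \<epsilon> v G * sample_weight m n \<epsilon> w G) \<in> borel_measurable (\<mu> \<Otimes>\<^sub>M ?N)"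
      by measurable
  qed
  also have "\<dots> \<le> (\<integral>\<^sup>+w. 2 * ennreal (exp (\<epsilon>\<^sup>2 / 2)) ^ m \<partial>\<mu>)"
  proof (rule nn_integral_mono_AE, use unit in eventually_elim)
    fix w assume w: "ip n w w = 1"
    have "(\<integral>\<^sup>+v. \<integral>\<^sup>+G. sample_weight m n \<epsilon> v G * sample_weight m n \<epsilon> w G \<partial>?N \<partial>\<mu>)
        \<le> (\<integral>\<^sup>+v. ennreal (exp (\<epsilon>\<^sup>2 / 2)) ^ m * inverse (ennreal (1 - (ip n v w)\<^sup>2)) ^ m \<partial>\<mu>)"
      by (rule nn_integral_mono_AE, use unit in eventually_elim) (rule nn_integral_sample_weight_product_le[OF _ w e])
    also have "\<dots> = ennreal (exp (\<epsilon>\<^sup>2 / 2)) ^ m * (\<integral>\<^sup>+v. inverse (ennreal (1 - (ip n v w)\<^sup>2)) ^ m \<partial>\<mu>)"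
      by (rule nn_integral_cmult) auto
    also have "\<dots> \<le> ennreal (exp (\<epsilon>\<^sup>2 / 2)) ^ m * 2"
      by (intro mult_left_mono bound[OF w]) simp
    finally show "(\<integral>\<^sup>+v. \<integral>\<^sup>+G. sample_weight m n \<epsilon> v G * sample_weight m n \<epsilon> w G \<partial>?N \<partial>\<mu>) \<le> 2 * ennreal (exp (\<epsilon>\<^sup>2 / 2)) ^ m"
      by (simp add: mult.commute)
  qed
  also have "\<dots> = 2 * ennreal (exp (\<epsilon>\<^sup>2 / 2)) ^ m"
    by (simp add: \<mu>.emeasure_space_1)
  finally show ?thesis by (simp add: mult_left_mono)
qed

subsection \<open>Hyperplane Gaussians as conditioned Gaussians\<close>

text \<open>For a unit vector v the map is the orthogonal projection, so this is the standard
  Gaussian on the hyperplane orthogonal to v.\<close>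

definition hyperplane_gaussian :: "nat \<Rightarrow> (nat \<Rightarrow> real) \<Rightarrow> (nat \<Rightarrow> real) measure" where
  "hyperplane_gaussian n v = distr (std_gaussian n) (borel_Rn n) (set_component n v 0)"

lemma sets_hyperplane_gaussian [measurable_cong, simp]: "sets (hyperplane_gaussian n v) = sets (borel_Rn n)"
  by (simp add: hyperplane_gaussian_def)

lemma prob_space_hyperplane_gaussian: "prob_space (hyperplane_gaussian n v)"
  unfolding hyperplane_gaussian_def by (rule std_gaussian.prob_space_distr) measurable

lemma set_component_in_Rn: "set_component n v s x \<in> Rn n"
  by (simp add: set_component_def Rn_def)

lemma emeasure_std_normal_singleton: "emeasure std_normal {a} = 0"
proof -
  have "emeasure std_normal {a} = (\<integral>\<^sup>+s. ennreal (std_normal_density s) * indicator {a} s \<partial>lborel)"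
    by (rule emeasure_density) auto
  also have "\<dots> = 0"
    by (subst nn_integral_0_iff_AE) (auto intro: eventually_mono[OF AE_lborel_singleton[of a]])
  finally show ?thesis .
qed

lemma slab_in_sets [measurable]: "{x \<in> Rn n. \<bar>ip n x v\<bar> \<le> \<epsilon>} \<in> sets (borel_Rn n)"
proof -
  have "{x \<in> space (borel_Rn n). \<bar>ip n x v\<bar> \<le> \<epsilon>} \<in> sets (borel_Rn n)" by measurable
  then show ?thesis by simp
qed

lemma hyperplane_in_sets [measurable]: "{x \<in> Rn n. ip n x v = 0} \<in> sets (borel_Rn n)"
proof -
  have "{x \<in> space (borel_Rn n). ip n x v = 0} \<in> sets (borel_Rn n)" by measurable
  then show ?thesis by simp
qed

lemma measure_std_gaussian_hyperplane:
  assumes v: "ip n v v = 1"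
  shows "measure (std_gaussian n) {x \<in> Rn n. ip n x v = 0} = 0"
proof -
  have "emeasure (std_gaussian n) {x \<in> Rn n. ip n x v = 0} = (\<integral>\<^sup>+x. indicator {0} (ip n x v) \<partial>std_gaussian n)"
  proof -
    have "(\<integral>\<^sup>+x. indicator {0} (ip n x v) \<partial>std_gaussian n) =
        (\<integral>\<^sup>+x. indicator {x \<in> Rn n. ip n x v = 0} x \<partial>std_gaussian n)"
      by (intro nn_integral_cong) (simp add: indicator_def)
    then show ?thesis by simp
  qed
  also have "\<dots> = (\<integral>\<^sup>+s. indicator {0} s \<partial>std_normal)"
    by (rule nn_integral_std_gaussian_ip[OF v]) auto
  also have "\<dots> = 0"
    by (simp add: emeasure_std_normal_singleton)
  finally show ?thesis by (simp add: measure_def)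
qed

text \<open>The hyperplane itself is the separating event: it carries all of one measure and is null
  for the other.\<close>

lemma tv_dist_hyperplane_gaussian:
  assumes v: "ip n v v = 1"
  shows "tv_dist (hyperplane_gaussian n v) (std_gaussian n) = 1"
proof -
  interpret D: prob_space "hyperplane_gaussian n v" by (rule prob_space_hyperplane_gaussian)
  let ?f = "\<lambda>A. \<bar>measure (hyperplane_gaussian n v) A - measure (std_gaussian n) A\<bar>"
  let ?K = "{x \<in> Rn n. ip n x v = 0}"
  have le: "?f A \<le> 1" for A
    using D.prob_le_1[of A] std_gaussian.prob_le_1[of n A] measure_nonneg[of "hyperplane_gaussian n v" A]
      measure_nonneg[of "std_gaussian n" A] by linarith
  have "measure (hyperplane_gaussian n v) ?K = measure (std_gaussian n) (space (std_gaussian n))"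
    unfolding hyperplane_gaussian_def
    by (subst measure_distr) (auto intro!: arg_cong[where f="measure _"] simp: set_component_in_Rn ip_set_component[OF v])
  then have 1: "?f ?K = 1"
    using measure_std_gaussian_hyperplane[OF v] std_gaussian.prob_space[of n] by simp
  show ?thesis
    unfolding tv_dist_def
  proof (rule antisym)
    show "(SUP A\<in>sets (hyperplane_gaussian n v). ?f A) \<le> 1"
      by (rule cSUP_least) (auto intro: le)
    have "?f ?K \<le> (SUP A\<in>sets (hyperplane_gaussian n v). ?f A)"
      by (rule cSUP_upper) (auto intro!: bdd_aboveI[of _ 1] le)
    then show "1 \<le> (SUP A\<in>sets (hyperplane_gaussian n v). ?f A)"
      using 1 by simp
  qed
qed

section \<open>Conditioning on slabs and the weak limit\<close>

lemma gaussian_cond_eq: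
  assumes [measurable]: "S \<in> sets (borel_Rn n)"
  shows "gaussian_cond n S = uniform_measure (std_gaussian n) S"
proof (rule measure_eqI)
  have id: "(\<lambda>x. x) \<in> uniform_measure (completion (std_gaussian n)) S \<rightarrow>\<^sub>M borel_Rn n"
    by (auto intro!: measurableI simp: space_completion sets_completionI_sets dest: sets.sets_into_space)
  fix A assume "A \<in> sets (gaussian_cond n S)"
  then have [measurable]: "A \<in> sets (borel_Rn n)" by (simp add: gaussian_cond_def)
  have "A \<inter> Rn n = A"
    using sets.sets_into_space[of A "borel_Rn n"] by auto
  then have "emeasure (gaussian_cond n S) A = emeasure (uniform_measure (completion (std_gaussian n)) S) A"
    unfolding gaussian_cond_def by (subst emeasure_distr[OF id]) auto
  also have "\<dots> = emeasure (completion (std_gaussian n)) (S \<inter> A) / emeasure (completion (std_gaussian n)) S"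
    by (rule emeasure_uniform_measure) (auto intro: sets_completionI_sets)
  also have "\<dots> = emeasure (uniform_measure (std_gaussian n) S) A"
    by (subst emeasure_uniform_measure) auto
  finally show "emeasure (gaussian_cond n S) A = emeasure (uniform_measure (std_gaussian n) S) A" .
qed (simp add: gaussian_cond_def)

text \<open>Composing with the restriction extends f to the whole type
  \<open>nat \<Rightarrow> real\<close>, so that continuity and Borel measurability can be treated
  in its product topology.\<close>

lemma continuous_map_Rn_restrict:
  assumes "continuous_map (Rn_topology n) euclideanreal f"
  shows "continuous_on UNIV (\<lambda>x. f (restrict x {..<n}))"
proof -
  have "continuous_map euclidean (Rn_topology n) (\<lambda>x. restrict x {..<n})"
    unfolding Rn_topology_def continuous_map_componentwise by auto
  from continuous_map_compose[OF this assms] show ?thesis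
    by (simp add: comp_def)
qed

lemma measurable_Rn_id: "(\<lambda>x. x) \<in> borel_measurable (borel_Rn n)"
proof (rule measurable_coordinatewise_then_product)
  fix i
  show "(\<lambda>x. x i) \<in> borel_measurable (borel_Rn n)"
  proof (cases "i < n")
    case True
    then show ?thesis by (intro measurable_Rn_component[of "\<lambda>x. x"]) auto
  next
    case False
    then have "x i = undefined" if "x \<in> space (borel_Rn n)" for x
      using that by (auto simp: Rn_def PiE_iff extensional_def)
    then show ?thesis by (subst measurable_cong[where g="\<lambda>_. undefined"]) auto
  qed
qed

lemma continuous_map_Rn_measurable:
  assumes "continuous_map (Rn_topology n) euclideanreal f"
  shows "f \<in> borel_measurable (borel_Rn n)"
proof -
  have "(\<lambda>x. f (restrict x {..<n})) \<in> borel_measurable (borel_Rn n)"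
    using measurable_compose[OF measurable_Rn_id borel_measurable_continuous_onI[OF continuous_map_Rn_restrict[OF assms]]] .
  then show ?thesis
    by (rule measurable_cong[THEN iffD1, rotated]) (simp add: Rn_def PiE_restrict)
qed

lemma continuous_on_set_component: "continuous_on UNIV (\<lambda>s. set_component n v s x)"
proof (rule continuous_on_coordinatewise_then_product)
  fix i
  show "continuous_on UNIV (\<lambda>s. set_component n v s x i)"
    by (cases "i < n") (auto simp: set_component_def intro!: continuous_intros)
qed

text \<open>The thickened hyperplane is a slab, and conditioning on it constrains only the component
  s along v. Averaging f over the other directions leaves a function F of s, and the conditioned
  integral is the mean of F under the normal law conditioned on [-\<epsilon>, \<epsilon>]. Since F
  is continuous at 0, this mean tends to F 0, the integral over the hyperplane.\<close>

lemma weak_limit_slab: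
  assumes v: "ip n v v = 1"
  shows "weak_limit_at_0 n (\<lambda>\<epsilon>. gaussian_cond n (thickening n \<epsilon> {x \<in> Rn n. ip n x v = 0})) (hyperplane_gaussian n v)"
  unfolding weak_limit_at_0_def
proof (intro allI impI)
  fix f assume f: "continuous_map (Rn_topology n) euclideanreal f" and bd: "bounded (f ` Rn n)"
  obtain B where B: "\<And>x. x \<in> Rn n \<Longrightarrow> \<bar>f x\<bar> \<le> B"
    using bd by (auto simp: bounded_iff)
  have [measurable]: "f \<in> borel_measurable (borel_Rn n)" by (rule continuous_map_Rn_measurable[OF f])
  interpret P: pair_sigma_finite "std_gaussian n" std_normal ..
  interpret PP: prob_space "std_gaussian n \<Otimes>\<^sub>M std_normal"
    by (intro prob_space_pair) unfold_locales
  define F where "F s = (\<integral>x. f (set_component n v s x) \<partial>std_gaussian n)" for s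
  have [measurable]: "F \<in> borel_measurable borel"
    unfolding F_def[abs_def] by measurable
  have FB: "\<bar>F s\<bar> \<le> B" for s
    unfolding F_def
    by (rule order_trans[OF integral_abs_bound]) (auto intro!: std_gaussian.integral_le_const std_gaussian.integrable_const_bound[where B=B] B set_component_in_Rn)
  \<comment> \<open>Dominated convergence: f is bounded, and moving the component along v is
    continuous for each fixed x.\<close>
  have cont: "isCont F 0"
    unfolding continuous_at_sequentially
  proof safe
    fix X :: "nat \<Rightarrow> real" assume X: "X \<longlonglongrightarrow> 0"
    have "(\<lambda>k. F (X k)) \<longlonglongrightarrow> F 0"
      unfolding F_def
    proof (rule integral_dominated_convergence[where w="\<lambda>_. B"])
      show "AE x in std_gaussian n. (\<lambda>k. f (set_component n v (X k) x)) \<longlonglongrightarrow> f (set_component n v 0 x)"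
      proof (rule AE_I2)
        fix x
        have r: "restrict (set_component n v s x) {..<n} = set_component n v s x" for s
          by (simp add: set_component_def)
        have "continuous_on UNIV (\<lambda>s. f (restrict (set_component n v s x) {..<n}))"
          by (rule continuous_on_compose2[OF continuous_map_Rn_restrict[OF f] continuous_on_set_component]) auto
        then have "isCont (\<lambda>s. f (set_component n v s x)) 0"
          by (simp add: r continuous_on_eq_continuous_at)
        then show "(\<lambda>k. f (set_component n v (X k) x)) \<longlonglongrightarrow> f (set_component n v 0 x)"
          using X by (rule isCont_tendsto_compose)
      qed
    qed (auto intro!: B set_component_in_Rn)
    then show "(F \<circ> X) \<longlonglongrightarrow> F 0" by (simp add: comp_def)
  qed
  have F0: "(\<integral>x. f x \<partial>hyperplane_gaussian n v) = F 0"
    unfolding hyperplane_gaussian_def F_def by (rule integral_distr) auto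
  define p where "p \<epsilon> = measure std_normal {-\<epsilon>..\<epsilon>}" for \<epsilon>
  have p_pos: "p \<epsilon> > 0" if "\<epsilon> > 0" for \<epsilon>
  proof -
    have pos: "std_normal_density s \<noteq> 0" for s
      using normal_density_pos[of 1 0 s] by simp
    have "emeasure std_normal {-\<epsilon>..\<epsilon>} \<noteq> 0"
    proof
      assume "emeasure std_normal {-\<epsilon>..\<epsilon>} = 0"
      then have "AE s in lborel. s \<in> {-\<epsilon>..\<epsilon>} \<longrightarrow> ennreal (std_normal_density s) = 0"
        by (subst (asm) emeasure_density; (subst (asm) nn_integral_0_iff_AE)?) (auto elim!: eventually_mono)
      then have "AE s in lborel. s \<notin> {-\<epsilon>..\<epsilon>}"
        by eventually_elim (use pos in auto)
      then have "emeasure lborel {-\<epsilon>..\<epsilon>} = 0"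
        by (subst (asm) AE_iff_measurable[where N="{-\<epsilon>..\<epsilon>}"]) auto
      then show False using that by simp
    qed
    then show ?thesis
      by (simp add: p_def std_normal.emeasure_eq_measure zero_less_measure_iff)
  qed
  \<comment> \<open>Bochner version of the resampling identity; boundedness of g provides the
    integrability that Fubini requires.\<close>
  have decomp: "(\<integral>x. g x \<partial>std_gaussian n) = (\<integral>s. \<integral>x. g (set_component n v s x) \<partial>std_gaussian n \<partial>std_normal)"
    if [measurable]: "g \<in> borel_measurable (borel_Rn n)" and gC: "\<And>x. x \<in> Rn n \<Longrightarrow> \<bar>g x\<bar> \<le> C" for g :: "_ \<Rightarrow> real" and C
  proof -
    have int: "integrable (std_gaussian n \<Otimes>\<^sub>M std_normal) (\<lambda>(x, s). g (set_component n v s x))"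
      by (rule PP.integrable_const_bound[where B=C]) (auto simp: gC set_component_in_Rn)
    have "(\<integral>x. g x \<partial>std_gaussian n) = (\<integral>x. g x \<partial>distr (std_gaussian n \<Otimes>\<^sub>M std_normal) (borel_Rn n) (\<lambda>(x, s). set_component n v s x))"
      by (simp only: distr_set_component_std_gaussian[OF v])
    also have "\<dots> = (\<integral>(x, s). g (set_component n v s x) \<partial>(std_gaussian n \<Otimes>\<^sub>M std_normal))"
      by (subst integral_distr) (auto simp: case_prod_unfold)
    also have "\<dots> = (\<integral>s. \<integral>x. g (set_component n v s x) \<partial>std_gaussian n \<partial>std_normal)"
      by (rule P.integral_snd[OF int, symmetric])
    finally show ?thesis .
  qed
  have eq: "(\<integral>x. f x \<partial>gaussian_cond n (thickening n \<epsilon> {x \<in> Rn n. ip n x v = 0})) =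
      (\<integral>s. indicator {-\<epsilon>..\<epsilon>} s * F s \<partial>std_normal) / p \<epsilon>" if e: "\<epsilon> > 0" for \<epsilon>
  proof -
    define S where "S = {x \<in> Rn n. \<bar>ip n x v\<bar> \<le> \<epsilon>}"
    have S[measurable]: "S \<in> sets (borel_Rn n)" by (simp add: S_def)
    have "thickening n \<epsilon> {x \<in> Rn n. ip n x v = 0} = S"
      using thickening_hyperplane[of v n \<epsilon>] v e by (simp add: ip_def S_def power2_eq_square)
    moreover have iS: "indicator S (set_component n v s x) = (indicator {-\<epsilon>..\<epsilon>} s :: real)" for s x
      by (auto simp: S_def indicator_def set_component_in_Rn ip_set_component[OF v])
    have pS: "measure (std_gaussian n) S = p \<epsilon>"
    proof -
      have "measure (std_gaussian n) S = (\<integral>x. indicator S x \<partial>std_gaussian n)"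
        using sets.sets_into_space[OF S] by (simp add: Int_absorb2)
      also have "\<dots> = (\<integral>s. \<integral>x. indicator S (set_component n v s x) \<partial>std_gaussian n \<partial>std_normal)"
        by (rule decomp[of "indicator S" 1]) (auto simp: indicator_def)
      also have "\<dots> = p \<epsilon>"
        unfolding iS using std_gaussian.prob_space[of n] by (simp add: p_def)
      finally show ?thesis .
    qed
    have "uniform_measure (std_gaussian n) S = density (std_gaussian n) (\<lambda>x. ennreal (indicator S x / p \<epsilon>))"
      unfolding uniform_measure_def using p_pos[OF e]
      by (intro density_cong)
         (auto simp: std_gaussian.emeasure_eq_measure pS divide_ennreal[symmetric] split: split_indicator)
    moreover have "(\<integral>x. f x \<partial>density (std_gaussian n) (\<lambda>x. ennreal (indicator S x / p \<epsilon>))) =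
        (\<integral>x. (indicator S x / p \<epsilon>) *\<^sub>R f x \<partial>std_gaussian n)"
      using p_pos[OF e] by (intro integral_density) auto
    moreover have "\<dots> = (\<integral>x. indicator S x * f x \<partial>std_gaussian n) / p \<epsilon>"
      by simp
    moreover have "(\<integral>x. indicator S x * f x \<partial>std_gaussian n) = (\<integral>s. indicator {-\<epsilon>..\<epsilon>} s * F s \<partial>std_normal)"
      by (subst decomp[of "\<lambda>x. indicator S x * f x" B]) (auto simp: iS F_def abs_mult split: split_indicator intro: B order_trans[OF abs_ge_zero B])
    ultimately show ?thesis
      by (simp add: gaussian_cond_eq[OF S])
  qed
  have "((\<lambda>\<epsilon>. (\<integral>s. indicator {-\<epsilon>..\<epsilon>} s * F s \<partial>std_normal) / p \<epsilon>) \<longlongrightarrow> F 0) (at_right 0)"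
  proof (rule tendstoI)
    fix \<delta> :: real assume d: "\<delta> > 0"
    obtain r where r: "r > 0" "\<And>s. \<bar>s\<bar> < r \<Longrightarrow> \<bar>F s - F 0\<bar> < \<delta> / 2"
    proof -
      have "\<delta> / 2 > 0" using d by simp
      with cont obtain r where "r > 0" "\<forall>s. \<bar>s - 0\<bar> < r \<longrightarrow> \<bar>F s - F 0\<bar> < \<delta> / 2"
        unfolding continuous_at_eps_delta dist_real_def by meson
      then show ?thesis by (intro that[of r]) auto
    qed
    have "\<forall>\<^sub>F \<epsilon> in at_right 0. \<epsilon> \<in> {0<..<r}"
      using r(1) by (rule eventually_at_right_real)
    then show "\<forall>\<^sub>F \<epsilon> in at_right 0. dist ((\<integral>s. indicator {-\<epsilon>..\<epsilon>} s * F s \<partial>std_normal) / p \<epsilon>) (F 0) < \<delta>"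
    proof eventually_elim
      case (elim \<epsilon>)
      then have e: "\<epsilon> > 0" "\<epsilon> < r" by auto
      have "0 \<le> B" using FB[of 0] by linarith
      then have int1: "integrable std_normal (\<lambda>s. indicator {-\<epsilon>..\<epsilon>} s * F s)"
        by (intro std_normal.integrable_const_bound[where B=B] AE_I2)
           (auto simp: abs_mult FB split: split_indicator)
      have int2: "integrable std_normal (\<lambda>s. indicator {-\<epsilon>..\<epsilon>} s * c)" for c :: real
        by (intro integrable_mult_left) (auto simp: std_normal.emeasure_eq_measure)
      have diff: "(\<integral>s. indicator {-\<epsilon>..\<epsilon>} s * F s \<partial>std_normal) - F 0 * p \<epsilon> = (\<integral>s. indicator {-\<epsilon>..\<epsilon>} s * F s - indicator {-\<epsilon>..\<epsilon>} s * F 0 \<partial>std_normal)"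
        by (subst Bochner_Integration.integral_diff[OF int1 int2]) (simp add: p_def)
      have "\<bar>(\<integral>s. indicator {-\<epsilon>..\<epsilon>} s * F s \<partial>std_normal) - F 0 * p \<epsilon>\<bar> \<le> (\<integral>s. \<bar>indicator {-\<epsilon>..\<epsilon>} s * F s - indicator {-\<epsilon>..\<epsilon>} s * F 0\<bar> \<partial>std_normal)"
        unfolding diff by (rule integral_abs_bound)
      also have "\<dots> \<le> (\<integral>s. indicator {-\<epsilon>..\<epsilon>} s * (\<delta> / 2) \<partial>std_normal)"
      proof (rule integral_mono)
        fix s
        show "\<bar>indicator {-\<epsilon>..\<epsilon>} s * F s - indicator {-\<epsilon>..\<epsilon>} s * F 0\<bar> \<le> indicator {-\<epsilon>..\<epsilon>} s * (\<delta> / 2)"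
        proof (cases "s \<in> {-\<epsilon>..\<epsilon>}")
          case True
          then have "\<bar>s\<bar> < r" using e by auto
          from r(2)[OF this] True show ?thesis by simp
        qed simp
      qed (intro integrable_abs Bochner_Integration.integrable_diff int1 int2)+
      also have "\<dots> = \<delta> / 2 * p \<epsilon>" by (simp add: p_def)
      finally have "\<bar>(\<integral>s. indicator {-\<epsilon>..\<epsilon>} s * F s \<partial>std_normal) - F 0 * p \<epsilon>\<bar> \<le> \<delta> / 2 * p \<epsilon>" .
      moreover have "(\<integral>s. indicator {-\<epsilon>..\<epsilon>} s * F s \<partial>std_normal) / p \<epsilon> - F 0 =
          ((\<integral>s. indicator {-\<epsilon>..\<epsilon>} s * F s \<partial>std_normal) - F 0 * p \<epsilon>) / p \<epsilon>"
        using p_pos[OF e(1)] by (simp add: field_simps)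
      ultimately have "\<bar>(\<integral>s. indicator {-\<epsilon>..\<epsilon>} s * F s \<partial>std_normal) / p \<epsilon> - F 0\<bar> \<le> \<delta> / 2"
        using p_pos[OF e(1)] by (simp add: abs_divide divide_le_eq)
      then show ?case using d by (simp add: dist_real_def)
    qed
  qed
  then show "((\<lambda>\<epsilon>. \<integral>x. f x \<partial>gaussian_cond n (thickening n \<epsilon> {x \<in> Rn n. ip n x v = 0})) \<longlongrightarrow> (\<integral>x. f x \<partial>hyperplane_gaussian n v)) (at_right 0)"
    unfolding F0
    by (rule Lim_transform_eventually) (auto simp: eq eventually_at_right_field intro!: exI[of _ 1])
qed

text \<open>The hyperplane is a Gaussian null set, so membership goes through the weak-limit clause
  of the conditioning.\<close>

lemma hyperplane_gaussian_in_P_symm: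
  assumes v: "ip n v v = 1"
  shows "hyperplane_gaussian n v \<in> P_symm n"
proof -
  let ?K = "{x \<in> Rn n. ip n x v = 0}"
  have "Rn_symmetric n ?K"
    by (auto simp: Rn_symmetric_def Rn_def ip_def sum_negf)
  moreover have "Rn_convex n ?K"
  proof -
    have "ip n (\<lambda>i\<in>{..<n}. a * x i + b * y i) v = a * ip n x v + b * ip n y v" for a b x y
      by (simp add: ip_def ring_distribs sum.distrib sum_distrib_left mult.assoc)
    then show ?thesis by (auto simp: Rn_convex_def Rn_def)
  qed
  moreover have "gaussian_vol n ?K = 0"
    unfolding gaussian_vol_def by (subst measure_completion) (auto simp: measure_std_gaussian_hyperplane[OF v])
  ultimately show ?thesis
    unfolding P_symm_def is_gaussian_on_def
    using weak_limit_slab[OF v] prob_space_hyperplane_gaussian[of n v] by (auto intro!: exI[of _ ?K])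
qed

subsection \<open>Indistinguishability\<close>

lemma PiM_distr_Rn:
  assumes "prob_space M" and f[measurable]: "f \<in> M \<rightarrow>\<^sub>M borel_Rn n"
  shows "PiM {..<m} (\<lambda>_. distr M (borel_Rn n) f) =
    distr (PiM {..<m} (\<lambda>_. M)) (sample_space m n) (\<lambda>\<omega>. \<lambda>i\<in>{..<m}. f (\<omega> i))"
proof -
  \<comment> \<open>\<open>std_gaussian n\<close> stands in for \<open>borel_Rn n\<close> as the
    target: it has the same measurable sets and is a probability measure, as the product rule for
    pushforwards requires.\<close>
  have f': "f \<in> M \<rightarrow>\<^sub>M std_gaussian n" by measurable
  have "distr (PiM {..<m} (\<lambda>_. M)) (gaussian_samples m n) (compose {..<m} f) =
      PiM {..<m} (\<lambda>_. distr M (std_gaussian n) f)"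
    using assms(1) prob_space_std_gaussian f' by (intro distr_PiM_finite_prob_space') auto
  moreover have "distr M (std_gaussian n) f = distr M (borel_Rn n) f"
    by (rule distr_cong) auto
  moreover have "distr (PiM {..<m} (\<lambda>_. M)) (gaussian_samples m n) (compose {..<m} f) =
      distr (PiM {..<m} (\<lambda>_. M)) (sample_space m n) (\<lambda>\<omega>. \<lambda>i\<in>{..<m}. f (\<omega> i))"
    by (rule distr_cong) (auto simp: compose_def)
  ultimately show ?thesis by simp
qed

section \<open>Passage to the singular limit through open sets\<close>

lemma measurable_sample_id: "(\<lambda>G. G) \<in> borel_measurable (sample_space m n)"
proof (intro measurable_coordinatewise_then_product)
  fix i j
  show "(\<lambda>G. G i j) \<in> borel_measurable (sample_space m n)"
  proof (cases "i < m")
    case True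
    then have "(\<lambda>G. G i) \<in> sample_space m n \<rightarrow>\<^sub>M borel_Rn n" by simp
    from measurable_compose[OF measurable_compose[OF this measurable_Rn_id] measurable_product_coordinates]
    show ?thesis by simp
  next
    case False
    then have "G i = undefined" if "G \<in> space (sample_space m n)" for G
      using that by (auto simp: space_PiM PiE_iff extensional_def)
    then show ?thesis by (subst measurable_cong[where g="\<lambda>_. undefined j"]) auto
  qed
qed

lemma open_Int_sample_space:
  assumes "open U"
  shows "U \<inter> space (sample_space m n) \<in> sets (sample_space m n)"
  using measurable_sets[OF measurable_sample_id borel_open[OF assms], of m n] by (simp add: vimage_def Int_def)

text \<open>A coupling proves this half of the portmanteau theorem: \<open>Y \<epsilon>\<close>
  builds the samples of every smearing level from the same Gaussian points and the same noise. As
  \<epsilon> tends to 0 it converges pointwise to the hyperplane samples, the indicator of an open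
  set is lower semicontinuous, and Fatou's lemma finishes.\<close>

lemma emeasure_hyperplane_samples_le_liminf:
  fixes m n :: nat and U :: "(nat \<Rightarrow> nat \<Rightarrow> real) set"
  assumes v: "ip n v v = 1" and U: "open U"
  defines "U' \<equiv> U \<inter> space (sample_space m n)"
  shows "emeasure (PiM {..<m} (\<lambda>_. hyperplane_gaussian n v)) U' \<le>
    liminf (\<lambda>k. emeasure (density (gaussian_samples m n) (sample_weight m n (1 / real (Suc k)) v)) U')"
proof -
  let ?M = "std_gaussian n \<Otimes>\<^sub>M unif"
  let ?\<Omega> = "PiM {..<m} (\<lambda>_. ?M)"
  have [measurable]: "U' \<in> sets (sample_space m n)"
    unfolding U'_def by (rule open_Int_sample_space[OF U])
  interpret M: prob_space ?M by (intro prob_space_pair prob_space_std_gaussian prob_space_unif)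
  define Y where "Y \<epsilon> \<omega> = (\<lambda>i\<in>{..<m}. set_component n v (\<epsilon> * snd (\<omega> i)) (fst (\<omega> i)))"
    for \<epsilon> and \<omega> :: "nat \<Rightarrow> (nat \<Rightarrow> real) \<times> real"
  have comp: "(\<lambda>z. set_component n v (\<epsilon> * snd z) (fst z)) \<in> ?M \<rightarrow>\<^sub>M borel_Rn n" for \<epsilon>
    by measurable
  have Y[measurable]: "Y \<epsilon> \<in> ?\<Omega> \<rightarrow>\<^sub>M sample_space m n" for \<epsilon>
    unfolding Y_def by (intro measurable_restrict measurable_compose[OF _ comp] measurable_component_singleton)
  have Y_dist: "PiM {..<m} (\<lambda>_. distr ?M (borel_Rn n) (\<lambda>z. set_component n v (\<epsilon> * snd z) (fst z))) =
      distr ?\<Omega> (sample_space m n) (Y \<epsilon>)" for \<epsilon>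
    unfolding Y_def by (rule PiM_distr_Rn[OF M.prob_space_axioms comp])
  have Y0: "PiM {..<m} (\<lambda>_. hyperplane_gaussian n v) = distr ?\<Omega> (sample_space m n) (Y 0)"
  proof -
    have "hyperplane_gaussian n v = distr (distr ?M (std_gaussian n) fst) (borel_Rn n) (set_component n v 0)"
      unfolding hyperplane_gaussian_def by (subst unif.distr_pair_fst) (rule refl)
    also have "\<dots> = distr ?M (borel_Rn n) (\<lambda>z. set_component n v (0 * snd z) (fst z))"
      by (subst distr_distr) (auto simp: comp_def)
    finally show ?thesis by (simp only: Y_dist)
  qed
  have Yk: "density (gaussian_samples m n) (sample_weight m n \<epsilon> v) = distr ?\<Omega> (sample_space m n) (Y \<epsilon>)"
    if e: "\<epsilon> > 0" for \<epsilon>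
  proof -
    have eq: "distr ?M (borel_Rn n) (\<lambda>z. set_component n v (\<epsilon> * snd z) (fst z)) =
        density (std_gaussian n) (\<lambda>x. slab_weight \<epsilon> (ip n x v))"
      using distr_set_component_unif[OF v e] by (simp add: case_prod_unfold)
    have "prob_space (density (std_gaussian n) (\<lambda>x. slab_weight \<epsilon> (ip n x v)))"
      unfolding eq[symmetric] by (rule M.prob_space_distr[OF comp])
    then have "PiM {..<m} (\<lambda>_. density (std_gaussian n) (\<lambda>x. slab_weight \<epsilon> (ip n x v))) =
        density (gaussian_samples m n) (sample_weight m n \<epsilon> v)"
      unfolding sample_weight_def[abs_def]
      by (intro PiM_density) (auto intro: prob_space_imp_sigma_finite prob_space_std_gaussian)
    then show ?thesis using Y_dist[of \<epsilon>] eq by simp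
  qed
  have "emeasure (PiM {..<m} (\<lambda>_. hyperplane_gaussian n v)) U' = (\<integral>\<^sup>+\<omega>. indicator U' (Y 0 \<omega>) \<partial>?\<Omega>)"
    unfolding Y0 by (simp add: nn_integral_indicator[symmetric] nn_integral_distr del: nn_integral_indicator)
  also have "\<dots> \<le> (\<integral>\<^sup>+\<omega>. liminf (\<lambda>k. indicator U' (Y (1 / real (Suc k)) \<omega>)) \<partial>?\<Omega>)"
  proof (rule nn_integral_mono)
    fix \<omega> assume \<omega>: "\<omega> \<in> space ?\<Omega>"
    show "indicator U' (Y 0 \<omega>) \<le> liminf (\<lambda>k. indicator U' (Y (1 / real (Suc k)) \<omega>) :: ennreal)"
    proof (cases "Y 0 \<omega> \<in> U'")
      case True
      have "continuous_on UNIV (\<lambda>\<epsilon>. Y \<epsilon> \<omega>)"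
      proof (rule continuous_on_coordinatewise_then_product)
        fix i
        show "continuous_on UNIV (\<lambda>\<epsilon>. Y \<epsilon> \<omega> i)"
        proof (cases "i < m")
          case True
          have "continuous_on UNIV (\<lambda>\<epsilon>. set_component n v (\<epsilon> * snd (\<omega> i)) (fst (\<omega> i)))"
            by (rule continuous_on_compose2[OF continuous_on_set_component]) (auto intro!: continuous_intros)
          with True show ?thesis by (simp add: Y_def)
        qed (simp add: Y_def)
      qed
      then have "isCont (\<lambda>\<epsilon>. Y \<epsilon> \<omega>) 0" by (simp add: continuous_on_eq_continuous_at)
      moreover have "(\<lambda>k. 1 / real (Suc k)) \<longlonglongrightarrow> 0"
        using LIMSEQ_inverse_real_of_nat by (simp add: inverse_eq_divide)
      ultimately have "(\<lambda>k. Y (1 / real (Suc k)) \<omega>) \<longlonglongrightarrow> Y 0 \<omega>"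
        by (rule isCont_tendsto_compose)
      then have "\<forall>\<^sub>F k in sequentially. Y (1 / real (Suc k)) \<omega> \<in> U"
        using U True by (auto simp: U'_def dest: topological_tendstoD)
      then have "\<forall>\<^sub>F k in sequentially. (1::ennreal) \<le> indicator U' (Y (1 / real (Suc k)) \<omega>)"
        by eventually_elim (use measurable_space[OF Y \<omega>] in \<open>auto simp: U'_def\<close>)
      then have "1 \<le> liminf (\<lambda>k. indicator U' (Y (1 / real (Suc k)) \<omega>) :: ennreal)"
        by (rule Liminf_bounded)
      then show ?thesis using True by simp
    qed simp
  qed
  also have "\<dots> \<le> liminf (\<lambda>k. \<integral>\<^sup>+\<omega>. indicator U' (Y (1 / real (Suc k)) \<omega>) \<partial>?\<Omega>)"
    by (rule nn_integral_liminf) measurable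
  also have "(\<lambda>k. \<integral>\<^sup>+\<omega>. indicator U' (Y (1 / real (Suc k)) \<omega>) \<partial>?\<Omega>) =
      (\<lambda>k. emeasure (density (gaussian_samples m n) (sample_weight m n (1 / real (Suc k)) v)) U')"
  proof
    fix k
    have "emeasure (density (gaussian_samples m n) (sample_weight m n (1 / real (Suc k)) v)) U' =
        emeasure (distr ?\<Omega> (sample_space m n) (Y (1 / real (Suc k)))) U'"
      by (subst Yk) auto
    then show "(\<integral>\<^sup>+\<omega>. indicator U' (Y (1 / real (Suc k)) \<omega>) \<partial>?\<Omega>) =
        emeasure (density (gaussian_samples m n) (sample_weight m n (1 / real (Suc k)) v)) U'"
      by (simp add: nn_integral_indicator[symmetric] nn_integral_distr del: nn_integral_indicator)
  qed
  finally show ?thesis .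
qed

text \<open>Outer regularity holds for finite Borel measures on the Polish type
  \<open>nat \<Rightarrow> nat \<Rightarrow> real\<close>, but E lives on the subspace of
  extensional functions. The samples are therefore pushed into the full type and E is pulled back
  along the restriction r, which is the identity on the sample space.\<close>

lemma exists_open_superset_samples:
  assumes E[measurable]: "E \<in> sets (sample_space m n)" and less: "emeasure (gaussian_samples m n) E < c"
  obtains U where "open U" "E \<subseteq> U" "emeasure (gaussian_samples m n) (U \<inter> space (sample_space m n)) < c"
proof -
  let ?N = "gaussian_samples m n"
  interpret N: prob_space ?N by (rule prob_space_gaussian_samples)
  note measurable_sample_id[measurable]
  define N' where "N' = distr ?N borel (\<lambda>G. G)"
  define r where "r G = (\<lambda>i\<in>{..<m}. \<lambda>j\<in>{..<n}. G i j)" for G :: "nat \<Rightarrow> nat \<Rightarrow> real"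
  have r[measurable]: "r \<in> borel \<rightarrow>\<^sub>M sample_space m n"
    unfolding r_def by (intro measurable_restrict measurable_RnI)
      (rule measurable_compose[OF measurable_product_coordinates measurable_product_coordinates])
  have r_id: "r G = G" if "G \<in> space (sample_space m n)" for G
    using that by (auto simp: r_def space_PiM Rn_def PiE_iff extensional_def fun_eq_iff)
  have id: "(\<lambda>G. G) \<in> ?N \<rightarrow>\<^sub>M borel" by measurable
  have sp: "space ?N = space (sample_space m n)"
    by (rule sets_eq_imp_space_eq) simp
  have E': "r -` E \<in> sets borel"
    using measurable_sets[OF r E] by simp
  have "r -` E \<inter> space ?N = E"
    using sets.sets_into_space[OF E] r_id by (auto simp: sp)
  then have "emeasure N' (r -` E) = emeasure ?N E"
    unfolding N'_def by (subst emeasure_distr[OF id E']) simp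
  moreover have "emeasure N' (r -` E) = (INF U \<in> {U. r -` E \<subseteq> U \<and> open U}. emeasure N' U)"
  proof (rule outer_regular)
    interpret N': prob_space N' unfolding N'_def by (rule N.prob_space_distr[OF id])
    show "emeasure N' (space N') \<noteq> \<infinity>" by simp
  qed (auto simp: N'_def E')
  ultimately have "(INF U \<in> {U. r -` E \<subseteq> U \<and> open U}. emeasure N' U) < c"
    using less by simp
  then obtain U where U: "r -` E \<subseteq> U" "open U" "emeasure N' U < c"
    unfolding INF_less_iff by auto
  have "E \<subseteq> r -` E"
    using sets.sets_into_space[OF E] r_id by auto
  moreover have "emeasure N' U = emeasure ?N (U \<inter> space (sample_space m n))"
    unfolding N'_def by (subst emeasure_distr[OF id]) (use U(2) in \<open>auto simp: sp\<close>)
  ultimately show ?thesis using U that by auto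
qed

text \<open>Each limit costs a little slack: 1/5 grows to 21/100 for the open superset, 4/5 drops to
  3/4 to turn the limit inferior into a strict bound for one k, and the factor exp (\<epsilon>^2 /
  2)^m is allowed to reach 13/10. The contradiction survives, since (3/4)^2 = 0.5625 exceeds 0.21 *
  2 * 1.3 = 0.546.\<close>

lemma hyperplane_samples_not_distinguishable:
  assumes n: "5 * m \<le> n" and m: "m > 0" and E: "E \<in> sets (sample_space m n)"
    and small: "emeasure (gaussian_samples m n) E \<le> ennreal (1 / 5)"
    and large: "\<And>v. ip n v v = 1 \<Longrightarrow> ennreal (4 / 5) \<le> emeasure (PiM {..<m} (\<lambda>_. hyperplane_gaussian n v)) E"
  shows False
proof -
  let ?N = "gaussian_samples m n"
  obtain \<mu> where \<mu>: "prob_space \<mu>" and sets_\<mu>[measurable_cong]: "sets \<mu> = sets (borel_Rn n)"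
    and unit: "AE v in \<mu>. ip n v v = 1"
    and bound: "\<forall>w. ip n w w = 1 \<longrightarrow> (\<integral>\<^sup>+v. inverse (ennreal (1 - (ip n v w)\<^sup>2)) ^ m \<partial>\<mu>) \<le> 2"
    by (rule exists_prior[OF n m])
  interpret \<mu>: prob_space \<mu> by fact
  interpret N: prob_space ?N by (rule prob_space_gaussian_samples)
  have "ennreal (1 / 5) < ennreal (21 / 100)" by (simp add: ennreal_less_iff)
  with small have "emeasure ?N E < ennreal (21 / 100)" by (rule le_less_trans)
  from exists_open_superset_samples[OF E this] obtain U where
    U: "open U" "E \<subseteq> U" "emeasure ?N (U \<inter> space (sample_space m n)) < ennreal (21 / 100)" .
  define U' where "U' = U \<inter> space (sample_space m n)"
  have [measurable]: "U' \<in> sets (sample_space m n)"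
    unfolding U'_def by (rule open_Int_sample_space[OF U(1)])
  define a where "a k v = emeasure (density ?N (sample_weight m n (1 / real (Suc k)) v)) U'" for k v
  have a_eq: "a k v = (\<integral>\<^sup>+G. sample_weight m n (1 / real (Suc k)) v G * indicator U' G \<partial>?N)"
    if "v \<in> space (borel_Rn n)" for k v
    unfolding a_def using that by (intro emeasure_density) measurable
  have [measurable]: "a k \<in> borel_measurable \<mu>" for k
  proof -
    have "(\<lambda>v. \<integral>\<^sup>+G. sample_weight m n (1 / real (Suc k)) v G * indicator U' G \<partial>?N) \<in> borel_measurable \<mu>"
      by measurable
    then show ?thesis
      by (rule measurable_cong[THEN iffD1, rotated]) (simp add: a_eq sets_eq_imp_space_eq[OF sets_\<mu>])
  qed
  have "ennreal (4 / 5) = (\<integral>\<^sup>+v. ennreal (4 / 5) \<partial>\<mu>)"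
    by (simp add: \<mu>.emeasure_space_1)
  also have "\<dots> \<le> (\<integral>\<^sup>+v. liminf (\<lambda>k. a k v) \<partial>\<mu>)"
  proof (rule nn_integral_mono_AE, use unit in eventually_elim)
    fix v assume v: "ip n v v = 1"
    have sets_D: "sets (PiM {..<m} (\<lambda>_. hyperplane_gaussian n v)) = sets (sample_space m n)"
      by (intro sets_PiM_cong) auto
    have "ennreal (4 / 5) \<le> emeasure (PiM {..<m} (\<lambda>_. hyperplane_gaussian n v)) E"
      by (rule large[OF v])
    also have "\<dots> \<le> emeasure (PiM {..<m} (\<lambda>_. hyperplane_gaussian n v)) U'"
      using U(2) sets.sets_into_space[OF E] by (intro emeasure_mono) (auto simp: U'_def[symmetric] sets_D, auto simp: U'_def)
    also have "\<dots> \<le> liminf (\<lambda>k. a k v)"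
      unfolding a_def U'_def by (rule emeasure_hyperplane_samples_le_liminf[OF v U(1)])
    finally show "ennreal (4 / 5) \<le> liminf (\<lambda>k. a k v)" .
  qed
  \<comment> \<open>A second use of Fatou's lemma, now over the prior, takes the limit out of the
    average, because the second moment bound concerns the mixture at a fixed \<epsilon>.\<close>
  also have "\<dots> \<le> liminf (\<lambda>k. \<integral>\<^sup>+v. a k v \<partial>\<mu>)"
    by (rule nn_integral_liminf) measurable
  finally have "ennreal (3 / 4) < liminf (\<lambda>k. \<integral>\<^sup>+v. a k v \<partial>\<mu>)"
    by (rule less_le_trans[rotated]) (simp add: ennreal_less_iff)
  then have 1: "\<forall>\<^sub>F k in sequentially. ennreal (3 / 4) < (\<integral>\<^sup>+v. a k v \<partial>\<mu>)"
    by (rule less_LiminfD)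
  have "(\<lambda>k. exp ((1 / real (Suc k))\<^sup>2 / 2) ^ m) \<longlonglongrightarrow> exp (0\<^sup>2 / 2) ^ m"
  proof (intro tendsto_intros)
    show "(\<lambda>k. 1 / real (Suc k)) \<longlonglongrightarrow> 0"
      using LIMSEQ_inverse_real_of_nat by (simp add: inverse_eq_divide)
  qed simp
  then have 2: "\<forall>\<^sub>F k in sequentially. exp ((1 / real (Suc k))\<^sup>2 / 2) ^ m < 13 / 10"
    by (rule order_tendstoD) simp
  obtain k where k: "ennreal (3 / 4) < (\<integral>\<^sup>+v. a k v \<partial>\<mu>)" "exp ((1 / real (Suc k))\<^sup>2 / 2) ^ m < 13 / 10"
    using eventually_happens[OF eventually_conj[OF 1 2]] by auto
  have "ennreal (3 / 4) ^ 2 \<le> (\<integral>\<^sup>+v. a k v \<partial>\<mu>)\<^sup>2"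
    using k(1) by (intro power_mono) auto
  also have "\<dots> \<le> emeasure ?N U' * (2 * ennreal (exp ((1 / real (Suc k))\<^sup>2 / 2)) ^ m)"
    unfolding a_def using mixture_sq_le[OF \<mu> sets_\<mu> unit bound[rule_format], of "1 / real (Suc k)" U'] by simp
  also have "\<dots> \<le> ennreal (21 / 100) * (2 * ennreal (13 / 10))"
    using U(3) k(2) by (intro mult_mono) (auto simp: U'_def ennreal_power intro!: ennreal_leI)
  also have "\<dots> = ennreal (546 / 1000)"
    using ennreal_mult[of "21 / 100" "2 * (13 / 10)"] ennreal_mult[of 2 "13 / 10"] by simp
  finally show False
    by (simp add: power2_eq_square ennreal_le_iff flip: ennreal_mult)
qed

text \<open>Derandomization: E collects the samples on which the algorithm answers
  \<open>Truncated\<close> with probability above 1/2. Off E that answer has probability at most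
  1/2, and on E the other answer has probability at most 1/2, so by Markov's inequality error 1/10
  becomes error 1/5. E is fixed before D, so one event serves all distributions.\<close>

lemma exists_test_event:
  assumes A: "A \<in> algorithms n m"
  obtains E where "E \<in> sets (sample_space m n)"
    "\<And>D. prob_space D \<Longrightarrow> sets D = sets (borel_Rn n) \<Longrightarrow> output_prob m A D Truncated \<ge> 9/10 \<Longrightarrow>
      ennreal (4 / 5) \<le> emeasure (PiM {..<m} (\<lambda>_. D)) E"
    "\<And>D. prob_space D \<Longrightarrow> sets D = sets (borel_Rn n) \<Longrightarrow> output_prob m A D Untruncated \<ge> 9/10 \<Longrightarrow>
      emeasure (PiM {..<m} (\<lambda>_. D)) E \<le> ennreal (1 / 5)"
proof
  have A'[measurable]: "A \<in> sample_space m n \<rightarrow>\<^sub>M prob_algebra (count_space UNIV)"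
    using A by (simp add: algorithms_def)
  define E where "E = {G \<in> space (sample_space m n). measure (A G) {Truncated} > 1 / 2}"
  have AG: "prob_space (A G)" "sets (A G) = UNIV" if "G \<in> space (sample_space m n)" for G
    using measurable_space[OF A' that] by (auto simp: space_prob_algebra)
  have [measurable]: "(\<lambda>G. emeasure (A G) {y}) \<in> borel_measurable (sample_space m n)" for y
    by (rule measurable_emeasure_kernel[OF measurable_prob_algebraD[OF A']]) simp
  then have [measurable]: "(\<lambda>G. measure (A G) {y}) \<in> borel_measurable (sample_space m n)" for y
    unfolding measure_def by measurable
  show E[measurable]: "E \<in> sets (sample_space m n)"
    unfolding E_def by measurable
  fix D :: "(nat \<Rightarrow> real) measure" assume D: "prob_space D" "sets D = sets (borel_Rn n)"
  let ?P = "PiM {..<m} (\<lambda>_. D)"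
  interpret P: prob_space ?P using D(1) by (intro prob_space_PiM) auto
  have sets_P[measurable_cong]: "sets ?P = sets (sample_space m n)"
    using D(2) by (intro sets_PiM_cong) auto
  have sp: "space ?P = space (sample_space m n)" by (rule sets_eq_imp_space_eq[OF sets_P])
  have A''[measurable]: "A \<in> ?P \<rightarrow>\<^sub>M prob_algebra (count_space UNIV)" by measurable
  have P: "?P \<in> space (prob_algebra ?P)"
    by (simp add: space_prob_algebra P.prob_space_axioms)
  have out: "output_prob m A D y = (\<integral>G. measure (A G) {y} \<partial>?P)" for y
  proof -
    have int: "integrable ?P (\<lambda>G. measure (A G) {y})"
      by (rule P.integrable_const_bound[where B=1]) (auto intro!: AE_I2 prob_space.prob_le_1 AG simp: sp)
    have "emeasure (?P \<bind> A) {y} = (\<integral>\<^sup>+G. emeasure (A G) {y} \<partial>?P)"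
      by (rule emeasure_bind_prob_algebra[OF P A'']) simp
    also have "\<dots> = (\<integral>\<^sup>+G. ennreal (measure (A G) {y}) \<partial>?P)"
      using AG(1) by (intro nn_integral_cong) (simp add: sp prob_space.finite_measure finite_measure.emeasure_eq_measure)
    also have "\<dots> = ennreal (\<integral>G. measure (A G) {y} \<partial>?P)"
      by (rule nn_integral_eq_integral[OF int]) simp
    finally show ?thesis by (simp add: output_prob_def measure_def)
  qed
  have int: "integrable ?P (\<lambda>G. measure (A G) {y})" for y
    by (rule P.integrable_const_bound[where B=1]) (auto intro!: AE_I2 prob_space.prob_le_1 AG simp: sp)
  have intE: "integrable ?P (\<lambda>G. indicator E G / 2 :: real)"
    by (intro integrable_divide) (auto simp: P.emeasure_eq_measure)
  have EE: "(\<integral>G. indicator E G / 2 \<partial>?P) = measure ?P E / 2"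
    using sets.sets_into_space[OF E] by (simp add: sp Int_absorb2)
  { assume "output_prob m A D Truncated \<ge> 9/10"
    then have "9/10 \<le> (\<integral>G. measure (A G) {Truncated} \<partial>?P)" by (simp add: out)
    also have "\<dots> \<le> (\<integral>G. 1 / 2 + indicator E G / 2 \<partial>?P)"
    proof (rule integral_mono[OF int])
      fix G assume "G \<in> space ?P"
      then show "measure (A G) {Truncated} \<le> 1 / 2 + indicator E G / 2"
        using prob_space.prob_le_1[OF AG(1), of G "{Truncated}"] by (auto simp: sp E_def split: split_indicator)
    qed (intro Bochner_Integration.integrable_add intE, simp)
    also have "\<dots> = 1 / 2 + measure ?P E / 2"
      by (subst Bochner_Integration.integral_add[OF _ intE]) (auto simp: P.prob_space EE simp del: integral_divide_zero)
    finally show "ennreal (4 / 5) \<le> emeasure ?P E"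
      by (simp add: P.emeasure_eq_measure ennreal_leI)
  }
  { assume "output_prob m A D Untruncated \<ge> 9/10"
    then have "9/10 \<le> (\<integral>G. measure (A G) {Untruncated} \<partial>?P)" by (simp add: out)
    also have "\<dots> \<le> (\<integral>G. 1 - indicator E G / 2 \<partial>?P)"
    proof (rule integral_mono[OF int])
      fix G assume G: "G \<in> space ?P"
      interpret AG: prob_space "A G" using AG(1) G by (simp add: sp)
      have "measure (A G) {Untruncated} + measure (A G) {Truncated} = measure (A G) {Untruncated, Truncated}"
        using AG.finite_measure_Union[of "{Untruncated}" "{Truncated}"] AG(2) G by (simp add: sp insert_commute)
      also have "\<dots> \<le> 1" by (rule AG.prob_le_1)
      finally show "measure (A G) {Untruncated} \<le> 1 - indicator E G / 2"
        using G measure_nonneg[of "A G" "{Truncated}"] by (auto simp: sp E_def split: split_indicator)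
    qed (intro Bochner_Integration.integrable_diff intE, simp)
    also have "\<dots> = 1 - measure ?P E / 2"
      by (subst Bochner_Integration.integral_diff[OF _ intE]) (auto simp: P.prob_space EE simp del: integral_divide_zero)
    finally show "emeasure ?P E \<le> ennreal (1 / 5)"
      by (simp add: P.emeasure_eq_measure ennreal_leI)
  }
qed

theorem theorem5p1:
  shows "\<exists>c>0. \<forall>(n::nat) (m::nat) A. A \<in> algorithms n m \<longrightarrow>
           output_prob m A (std_gaussian n) Untruncated \<ge> 9/10 \<longrightarrow>
           (\<forall>D \<in> P_symm n. tv_dist D (std_gaussian n) = 1 \<longrightarrow> output_prob m A D Truncated \<ge> 9/10) \<longrightarrow>
           real m \<ge> c * real n"
proof (intro exI[of _ "1/5"] conjI allI impI)
  fix n m :: nat and A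
  assume A: "A \<in> algorithms n m"
    and untruncated: "output_prob m A (std_gaussian n) Untruncated \<ge> 9/10"
    and truncated: "\<forall>D \<in> P_symm n. tv_dist D (std_gaussian n) = 1 \<longrightarrow> output_prob m A D Truncated \<ge> 9/10"
  show "real m \<ge> 1/5 * real n"
  proof (rule ccontr)
    assume "\<not> real m \<ge> 1/5 * real n"
    \<comment> \<open>The strict inequality also gives n > 0 when m = 0, so a unit vector exists in
      that case.\<close>
    then have n: "5 * m < n" by linarith
    obtain E where E: "E \<in> sets (sample_space m n)"
      and large: "\<And>D. prob_space D \<Longrightarrow> sets D = sets (borel_Rn n) \<Longrightarrow> output_prob m A D Truncated \<ge> 9/10 \<Longrightarrow>
        ennreal (4 / 5) \<le> emeasure (PiM {..<m} (\<lambda>_. D)) E"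
      and small: "\<And>D. prob_space D \<Longrightarrow> sets D = sets (borel_Rn n) \<Longrightarrow> output_prob m A D Untruncated \<ge> 9/10 \<Longrightarrow>
        emeasure (PiM {..<m} (\<lambda>_. D)) E \<le> ennreal (1 / 5)"
      using exists_test_event[OF A] by blast
    have 1: "emeasure (gaussian_samples m n) E \<le> ennreal (1 / 5)"
      by (rule small[OF prob_space_std_gaussian _ untruncated]) simp
    have 2: "ennreal (4 / 5) \<le> emeasure (PiM {..<m} (\<lambda>_. hyperplane_gaussian n v)) E" if v: "ip n v v = 1" for v
      using truncated hyperplane_gaussian_in_P_symm[OF v] tv_dist_hyperplane_gaussian[OF v]
      by (intro large prob_space_hyperplane_gaussian) auto
    show False
    proof (cases "m = 0")
      \<comment> \<open>The prior is only constructed for positive m. Without samples all product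
        measures coincide, so any single unit vector yields the contradiction 4/5 \<le> 1/5.\<close>
      case True
      have "ennreal (4 / 5) \<le> emeasure (PiM {..<m} (\<lambda>_. hyperplane_gaussian n (normalize_Rn n (\<lambda>_. 0)))) E"
        using n by (intro 2 normalize_Rn_unit) simp
      also have "\<dots> = emeasure (gaussian_samples m n) E"
        by (simp add: True PiM_empty)
      finally have "ennreal (4 / 5) \<le> ennreal (1 / 5)"
        using 1 by (rule order_trans)
      then show False by (simp add: ennreal_le_iff)
    next
      case False
      then show False
        using hyperplane_samples_not_distinguishable[OF _ _ E 1 2] n by simp
    qed
  qed
qed simp

end
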